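(* Let $\mathcal{H}$ be a separable quaternionic Hilbert space, let $J\in\mathcal{B}(\mathcal{H})$ be anti-selfadjoint and unitary, and let $i\in\mathbb{S}$. Suppose that $T$ is a compact operator on $\mathcal{H}$ with $[T,J]=0$ and that $1\le p<+\infty$. Then $T$ is in $S_p(J)$ if and only if $$\sum_{n}|\langle e_n,Te_n\rangle|^p<+\infty$$ for all orthonormal sets $(e_n)_n$ in $\mathcal{H}_+^{Ji}$. If $T$ is also selfadjoint, then $$\|T\|_p=\sup\left\{\Big[\sum_{n}|\langle e_n,Te_n\rangle|^p\Big]^{\frac1p}:\{e_n\}\text{ orthonormal set in }\mathcal{H}_+^{Ji}\right\}.$$
   Context: $\mathbb{H}$ denotes the quaternions, $\mathbb{S}=\{x\in\mathbb{H}:\operatorname{Re}(x)=0,\ |x|=1\}$ and $\mathbb{C}_i=\{a+ib:a,b\in\mathbb{R}\}$ for $i\in\mathbb{S}$. A quaternionic Hilbert space $\mathcal{H}$ is a right $\mathbb{H}$-vector space with a scalar product $\langle\cdot,\cdot\rangle:\mathcal{H}\times\mathcal{H}\to\mathbb{H}$ that is positive definite, right linear in the second argument, satisfies $\langle x,y\rangle=\overline{\langle y,x\rangle}$, and is complete for $\|x\|=\sqrt{\langle x,x\rangle}$. $\mathcal{B}(\mathcal{H})$ is the set of bounded right $\mathbb{H}$-linear operators, $\mathcal{B}_0(\mathcal{H})$ the set of compact ones. The adjoint is defined by $\langle T^*x,y\rangle=\langle x,Ty\rangle$; $J$ anti-selfadjoint and unitary means $J^*=-J$ and $J^*=J^{-1}$;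 $[T,J]=TJ-JT$. $\mathcal{H}_+^{Ji}=\{x\in\mathcal{H}:Jx=xi\}$, a complex Hilbert space over $\mathbb{C}_i$ with right scalar multiplication and the restricted scalar product. For $T\in\mathcal{B}_0(\mathcal{H})$ the singular values $(\lambda_n(T))_{n\in\mathbb{N}}$ are the eigenvalues of $|T|=\sqrt{T^*T}$ (non-negative reals) in decreasing order, counted with multiplicity. For $p\in(0,+\infty)$, $S_p(J)=\{T\in\mathcal{B}_0(\mathcal{H}):[T,J]=0,\ (\lambda_n(T))_n\in\ell^p\}$ and $\|T\|_p=(\sum_n\lambda_n(T)^p)^{1/p}$ (with value $+\infty$ if the sum diverges). *)

theory Defs
  imports "HOL-Analysis.Analysis"
begin

section \<open>Quaternions\<close>

datatype quat = Quat (qRe: real) (qIm1: real) (qIm2: real) (qIm3: real)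

lemma quat_eq_iff:
  "x = y \<longleftrightarrow> qRe x = qRe y \<and> qIm1 x = qIm1 y \<and> qIm2 x = qIm2 y \<and> qIm3 x = qIm3 y"
  using quat.expand by auto

definition qcnj :: "quat \<Rightarrow> quat"
  where "qcnj x = Quat (qRe x) (- qIm1 x) (- qIm2 x) (- qIm3 x)"

lemma qcnj_simps [simp]:
  "qRe (qcnj x) = qRe x" "qIm1 (qcnj x) = - qIm1 x"
  "qIm2 (qcnj x) = - qIm2 x" "qIm3 (qcnj x) = - qIm3 x"
  by (simp_all add: qcnj_def)

instantiation quat :: "{ring_1, real_vector}"
begin

definition "0 = Quat 0 0 0 0"
definition "1 = Quat 1 0 0 0"
definition "x + y = Quat (qRe x + qRe y) (qIm1 x + qIm1 y) (qIm2 x + qIm2 y) (qIm3 x + qIm3 y)"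
definition "- x = Quat (- qRe x) (- qIm1 x) (- qIm2 x) (- qIm3 x)"
definition "x - y = Quat (qRe x - qRe y) (qIm1 x - qIm1 y) (qIm2 x - qIm2 y) (qIm3 x - qIm3 y)"
definition "scaleR r x = Quat (r * qRe x) (r * qIm1 x) (r * qIm2 x) (r * qIm3 x)"
definition "x * y = Quat
  (qRe x * qRe y - qIm1 x * qIm1 y - qIm2 x * qIm2 y - qIm3 x * qIm3 y)
  (qRe x * qIm1 y + qIm1 x * qRe y + qIm2 x * qIm3 y - qIm3 x * qIm2 y)
  (qRe x * qIm2 y - qIm1 x * qIm3 y + qIm2 x * qRe y + qIm3 x * qIm1 y)
  (qRe x * qIm3 y + qIm1 x * qIm2 y - qIm2 x * qIm1 y + qIm3 x * qRe y)"

instance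
  by standard
    (simp_all add: zero_quat_def one_quat_def plus_quat_def uminus_quat_def minus_quat_def
      scaleR_quat_def times_quat_def quat_eq_iff algebra_simps)

end

lemma quat_simps [simp]:
  "qRe 0 = 0" "qIm1 0 = 0" "qIm2 0 = 0" "qIm3 0 = 0"
  "qRe 1 = 1" "qIm1 1 = 0" "qIm2 1 = 0" "qIm3 1 = 0"
  "qRe (x + y) = qRe x + qRe y" "qIm1 (x + y) = qIm1 x + qIm1 y"
  "qIm2 (x + y) = qIm2 x + qIm2 y" "qIm3 (x + y) = qIm3 x + qIm3 y"
  "qRe (- x) = - qRe x" "qIm1 (- x) = - qIm1 x" "qIm2 (- x) = - qIm2 x" "qIm3 (- x) = - qIm3 x"
  "qRe (x - y) = qRe x - qRe y" "qIm1 (x - y) = qIm1 x - qIm1 y"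
  "qIm2 (x - y) = qIm2 x - qIm2 y" "qIm3 (x - y) = qIm3 x - qIm3 y"
  "qRe (scaleR r x) = r * qRe x" "qIm1 (scaleR r x) = r * qIm1 x"
  "qIm2 (scaleR r x) = r * qIm2 x" "qIm3 (scaleR r x) = r * qIm3 x"
  by (simp_all add: zero_quat_def one_quat_def plus_quat_def uminus_quat_def minus_quat_def
      scaleR_quat_def)

lemma quat_mult_simps [simp]:
  "qRe (x * y) = qRe x * qRe y - qIm1 x * qIm1 y - qIm2 x * qIm2 y - qIm3 x * qIm3 y"
  "qIm1 (x * y) = qRe x * qIm1 y + qIm1 x * qRe y + qIm2 x * qIm3 y - qIm3 x * qIm2 y"
  "qIm2 (x * y) = qRe x * qIm2 y - qIm1 x * qIm3 y + qIm2 x * qRe y + qIm3 x * qIm1 y"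
  "qIm3 (x * y) = qRe x * qIm3 y + qIm1 x * qIm2 y - qIm2 x * qIm1 y + qIm3 x * qRe y"
  by (simp_all add: times_quat_def)

instantiation quat :: real_inner
begin

definition "inner x y = qRe x * qRe y + qIm1 x * qIm1 y + qIm2 x * qIm2 y + qIm3 x * qIm3 y"
definition "norm (x::quat) = sqrt (inner x x)"
definition "sgn (x::quat) = x /\<^sub>R norm x"
definition "dist (x::quat) y = norm (x - y)"
definition [code del]:
  "(uniformity :: (quat \<times> quat) filter) = (INF e\<in>{0<..}. principal {(x, y). dist x y < e})"
definition [code del]:
  "open (U :: quat set) \<longleftrightarrow> (\<forall>x\<in>U. eventually (\<lambda>(x', y). x' = x \<longrightarrow> y \<in> U) uniformity)"

instance
proof
  fix x y z :: quat and r :: real and U :: "quat set"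
  show "inner x x = 0 \<longleftrightarrow> x = 0"
    by (auto simp: inner_quat_def quat_eq_iff add_nonneg_eq_0_iff)
qed (simp_all add: inner_quat_def norm_quat_def sgn_quat_def dist_quat_def uniformity_quat_def
    open_quat_def algebra_simps)

end

instantiation quat :: real_normed_div_algebra
begin

definition "inverse x = qcnj x /\<^sub>R (norm x)\<^sup>2" for x :: quat
definition "x div y = x * inverse y" for x y :: quat

instance
proof
  fix x y :: quat and a :: real
  have sq: "(norm z)\<^sup>2 = qRe z * qRe z + qIm1 z * qIm1 z + qIm2 z * qIm2 z + qIm3 z * qIm3 z"
    for z :: quat
    by (simp add: power2_norm_eq_inner inner_quat_def)
  show sl: "a *\<^sub>R x * y = a *\<^sub>R (x * y)" and sr: "x * a *\<^sub>R y = a *\<^sub>R (x * y)"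
    by (simp_all add: quat_eq_iff algebra_simps)
  have "x * qcnj x = (norm x)\<^sup>2 *\<^sub>R 1" "qcnj x * x = (norm x)\<^sup>2 *\<^sub>R 1"
    by (simp_all add: quat_eq_iff sq algebra_simps)
  moreover have "c *\<^sub>R u * v = c *\<^sub>R (u * v)" "u * c *\<^sub>R v = c *\<^sub>R (u * v)"
    for c :: real and u v :: quat
    by (simp_all add: quat_eq_iff algebra_simps)
  ultimately show "x \<noteq> 0 \<Longrightarrow> inverse x * x = 1" "x \<noteq> 0 \<Longrightarrow> x * inverse x = 1"
    by (simp_all add: inverse_quat_def)
  show "inverse (0::quat) = 0"
    by (simp add: inverse_quat_def)
  show "x div y = x * inverse y"
    by (simp add: divide_quat_def)
  have "(norm (x * y))\<^sup>2 = (norm x * norm y)\<^sup>2"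
    unfolding power_mult_distrib sq by simp algebra
  then show "norm (x * y) = norm x * norm y"
    by simp
qed

end

definition imag_units :: "quat set"
  where "imag_units = {q. qRe q = 0 \<and> norm q = 1}"


section \<open>Quaternionic Hilbert spaces\<close>

text \<open>
  The underlying real structure is that of \<^class>\<open>real_inner\<close>: real scalars act through their
  image in the quaternions, and the real scalar product is the real part of the quaternionic one,
  so that the norm is the root of \<open>qinner x x\<close>.
\<close>

class quat_inner = real_inner +
  fixes rscaleQ :: "'a \<Rightarrow> quat \<Rightarrow> 'a"  (infixl \<open>*\<^sub>Q\<close> 75)
    and qinner :: "'a \<Rightarrow> 'a \<Rightarrow> quat"
  assumes rscaleQ_add_left: "(x + y) *\<^sub>Q q = x *\<^sub>Q q + y *\<^sub>Q q"
    and rscaleQ_add_right: "x *\<^sub>Q (q + r) = x *\<^sub>Q q + x *\<^sub>Q r"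
    and rscaleQ_mult: "x *\<^sub>Q (q * r) = x *\<^sub>Q q *\<^sub>Q r"
    and rscaleQ_one: "x *\<^sub>Q 1 = x"
    and rscaleQ_of_real: "x *\<^sub>Q of_real a = a *\<^sub>R x"
    and qinner_add_right: "qinner x (y + z) = qinner x y + qinner x z"
    and qinner_rscaleQ_right: "qinner x (y *\<^sub>Q q) = qinner x y * q"
    and qinner_commute: "qinner x y = qcnj (qinner y x)"
    and qinner_pos: "x \<noteq> 0 \<Longrightarrow> 0 < qRe (qinner x x)"
    and qRe_qinner: "qRe (qinner x y) = inner x y"

class quat_hilbert = quat_inner + complete_space

definition qorthonormal :: "'a::quat_inner set \<Rightarrow> bool"
  where "qorthonormal E \<longleftrightarrow> (\<forall>x\<in>E. \<forall>y\<in>E. qinner x y = (if x = y then 1 else 0))"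

text \<open>
  As for the dimension of real vector spaces in the library, a subspace without a finite basis
  gets dimension 0.
\<close>

definition qspan :: "'a::quat_inner set \<Rightarrow> 'a set"
  where "qspan B = {(\<Sum>x\<in>F. x *\<^sub>Q c x) | F c. finite F \<and> F \<subseteq> B}"

definition qindependent :: "'a::quat_inner set \<Rightarrow> bool"
  where "qindependent B \<longleftrightarrow>
    (\<forall>F c. finite F \<and> F \<subseteq> B \<and> (\<Sum>x\<in>F. x *\<^sub>Q c x) = 0 \<longrightarrow> (\<forall>x\<in>F. c x = 0))"

definition qdim :: "'a::quat_inner set \<Rightarrow> nat"
  where "qdim V = card (SOME B. qindependent B \<and> qspan B = V)"


section \<open>Operators\<close>

definition bounded_ops :: "('a::quat_inner \<Rightarrow> 'a) set"
  where "bounded_ops = {T. bounded_linear T \<and> (\<forall>x q. T (x *\<^sub>Q q) = T x *\<^sub>Q q)}"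

definition compact_ops :: "('a::quat_inner \<Rightarrow> 'a) set"
  where "compact_ops = {T \<in> bounded_ops. compact (closure (T ` cball 0 1))}"

definition qadjoint :: "('a::quat_inner \<Rightarrow> 'a) \<Rightarrow> 'a \<Rightarrow> 'a"
  where "qadjoint T = (THE S. \<forall>x y. qinner (S x) y = qinner x (T y))"

definition selfadjoint :: "('a::quat_inner \<Rightarrow> 'a) \<Rightarrow> bool"
  where "selfadjoint T \<longleftrightarrow> qadjoint T = T"

definition anti_selfadjoint :: "('a::quat_inner \<Rightarrow> 'a) \<Rightarrow> bool"
  where "anti_selfadjoint T \<longleftrightarrow> qadjoint T = (\<lambda>x. - T x)"

definition unitary :: "('a::quat_inner \<Rightarrow> 'a) \<Rightarrow> bool"
  where "unitary T \<longleftrightarrow> qadjoint T \<circ> T = id \<and> T \<circ> qadjoint T = id"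

definition commutator :: "('a::quat_inner \<Rightarrow> 'a) \<Rightarrow> ('a \<Rightarrow> 'a) \<Rightarrow> 'a \<Rightarrow> 'a"
  where "commutator S T = (\<lambda>x. S (T x) - T (S x))"

definition positive_op :: "('a::quat_inner \<Rightarrow> 'a) \<Rightarrow> bool"
  where "positive_op T \<longleftrightarrow> selfadjoint T \<and> (\<forall>x. \<exists>r\<ge>0. qinner x (T x) = of_real r)"

definition sqrt_op :: "('a::quat_inner \<Rightarrow> 'a) \<Rightarrow> 'a \<Rightarrow> 'a"
  where "sqrt_op A = (THE P. P \<in> bounded_ops \<and> positive_op P \<and> P \<circ> P = A)"

definition abs_op :: "('a::quat_inner \<Rightarrow> 'a) \<Rightarrow> 'a \<Rightarrow> 'a"
  where "abs_op T = sqrt_op (qadjoint T \<circ> T)"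

definition plus_space :: "('a::quat_inner \<Rightarrow> 'a) \<Rightarrow> quat \<Rightarrow> 'a set"
  where "plus_space J i = {x. J x = x *\<^sub>Q i}"


section \<open>Singular values and Schatten classes\<close>

definition real_eigenspace :: "('a::quat_inner \<Rightarrow> 'a) \<Rightarrow> real \<Rightarrow> 'a set"
  where "real_eigenspace A l = {x. A x = x *\<^sub>Q of_real l}"

text \<open>
  Every positive eigenvalue of \<open>|T|\<close> is listed as often as its multiplicity, in decreasing order.
  If there are finitely many of them, the list is continued by 0; if there are infinitely many,
  the eigenvalue 0 is never reached. For compact \<open>T\<close> this determines the sequence.
\<close>

definition singular_value :: "('a::quat_inner \<Rightarrow> 'a) \<Rightarrow> nat \<Rightarrow> real"
  where "singular_value T = (THE s. decseq s \<and> (\<forall>n. 0 \<le> s n) \<and>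
    (\<forall>l>0. finite {n. s n = l} \<and> card {n. s n = l} = qdim (real_eigenspace (abs_op T) l)))"

text \<open>The \<open>p\<close>-norm of a family, with value \<open>\<infinity>\<close> for families that are not \<open>p\<close>-summable.\<close>

definition lp_norm :: "real \<Rightarrow> ('i \<Rightarrow> 'b::real_normed_vector) \<Rightarrow> 'i set \<Rightarrow> ennreal"
  where "lp_norm p f A =
    (if (\<lambda>i. norm (f i) powr p) summable_on A
     then ennreal ((\<Sum>\<^sub>\<infinity>i\<in>A. norm (f i) powr p) powr (1 / p)) else \<infinity>)"

definition schatten_norm :: "real \<Rightarrow> ('a::quat_inner \<Rightarrow> 'a) \<Rightarrow> ennreal"
  where "schatten_norm p T = lp_norm p (singular_value T) UNIV"

definition schatten_class :: "real \<Rightarrow> ('a::quat_inner \<Rightarrow> 'a) \<Rightarrow> ('a \<Rightarrow> 'a) set"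
  where "schatten_class p J = {T \<in> compact_ops. commutator T J = (\<lambda>x. 0) \<and>
    summable (\<lambda>n. singular_value T n powr p)}"

end

theory Submission
  imports Defs
begin

text \<open>
  A compact operator \<open>T\<close> commuting with \<open>J\<close> has an orthonormal basis \<open>E\<close> of \<open>\<H>\<close> inside the plus
  space that diagonalizes \<open>T\<^sup>* T\<close>, and the singular values are the numbers \<open>\<parallel>T e\<parallel>\<close>, \<open>e \<in> E\<close>. For
  orthonormal \<open>g\<close> the expansion \<open>\<langle>g, T g\<rangle> = \<Sum>\<^sub>e \<langle>g, T e\<rangle> \<langle>e, g\<rangle>\<close> together with Bessel's and Jensen's
  inequalities gives \<open>\<Sum>\<^sub>g |\<langle>g, T g\<rangle>|\<^sup>p \<le> \<Sum>\<^sub>e \<parallel>T e\<parallel>\<^sup>p\<close>, with equality for an eigenbasis of a selfadjoint \<open>T\<close>.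
  Conversely, the selfadjoint and anti-selfadjoint parts of \<open>T\<close> have eigenbases in the plus
  space on which their diagonals are dominated by that of \<open>T\<close>; so both parts have \<open>p\<close>-summable
  singular values, and this passes to their sum.
\<close>

\<comment> \<open>For a non-normal \<open>T\<close> an entry \<open>\<langle>e, T e\<rangle>\<close>
  may vanish although \<open>T e\<close> does not, so for the converse the diagonal on a basis of
  eigenvectors of \<open>T\<^sup>* T\<close> does not reveal the singular values. They are the
  off-diagonal entries \<open>\<langle>f, T e\<rangle>\<close>, where \<open>f\<close> is the
  normalized \<open>T e\<close>. For this reason diagonal sums are bounded in the form
  \<open>\<langle>x k, T (y k)\<rangle>\<close> with two independent families: the same bound then
  controls such entries of both parts of \<open>T\<close>, each through its own eigenbasis.
  Eigenvectors have to be found inside the plus space, which is not closed under quaternionic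
  scalars. As the eigenvalues of a selfadjoint operator are real, the search can take place in
  closed real subspaces of the plus space, and commutation with \<open>J\<close> keeps these
  invariant.\<close>
subclass (in quat_hilbert) banach ..

section \<open>Quaternionic inner products\<close>

lemma qcnj_mult: "qcnj (x * y) = qcnj y * qcnj x"
  and qcnj_qcnj [simp]: "qcnj (qcnj x) = x"
  and qcnj_add: "qcnj (x + y) = qcnj x + qcnj y"
  and qcnj_zero [simp]: "qcnj 0 = 0"
  by (simp_all add: quat_eq_iff algebra_simps)

lemma quat_of_real_simps [simp]:
  "qRe (of_real r) = r" "qIm1 (of_real r) = 0" "qIm2 (of_real r) = 0" "qIm3 (of_real r) = 0"
  by (simp_all add: of_real_def)

lemma qcnj_of_real [simp]: "qcnj (of_real r) = of_real r"
  by (simp add: quat_eq_iff)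

lemma quat_norm_sq: "(norm z)\<^sup>2 = (qRe z)\<^sup>2 + (qIm1 z)\<^sup>2 + (qIm2 z)\<^sup>2 + (qIm3 z)\<^sup>2" for z :: quat
  unfolding power2_norm_eq_inner inner_quat_def by (simp add: power2_eq_square)

lemma norm_qcnj [simp]: "norm (qcnj z) = norm z"
  by (rule power2_eq_imp_eq) (simp_all add: quat_norm_sq)

lemma qcnj_times_self: "qcnj z * z = of_real ((norm z)\<^sup>2)" "z * qcnj z = of_real ((norm z)\<^sup>2)"
  unfolding quat_norm_sq by (simp_all add: quat_eq_iff power2_eq_square)

text \<open>Testing with \<open>q = qcnj (a - b)\<close> gives \<open>|a - b|^2 = 0\<close>. This is
  the passage from real scalar products, which only see real parts, to quaternionic ones.\<close>

lemma quat_eqI_Re: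
  assumes "\<And>q. qRe (a * q) = qRe (b * q)" shows "a = b"
proof -
  have "(norm (a - b))\<^sup>2 = qRe ((a - b) * qcnj (a - b))"
    by (simp only: qcnj_times_self quat_of_real_simps)
  also have "\<dots> = 0"
    using assms[of "qcnj (a - b)"] by (simp add: algebra_simps)
  finally show ?thesis by simp
qed

lemma qinner_add_left: "qinner (x + y) z = qinner x z + qinner y z"
  by (metis qinner_add_right qinner_commute qcnj_add)

lemma qinner_rscaleQ_left: "qinner (x *\<^sub>Q q) y = qcnj q * qinner x y"
  by (metis qinner_rscaleQ_right qinner_commute qcnj_mult qcnj_qcnj)

lemma qinner_scaleR_right: "qinner x (r *\<^sub>R y) = r *\<^sub>R qinner x y"
  by (metis qinner_rscaleQ_right rscaleQ_of_real Real_Vector_Spaces.of_real_def mult_scaleR_right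
      mult.right_neutral)

lemma qinner_scaleR_left: "qinner (r *\<^sub>R x) y = r *\<^sub>R qinner x y"
  by (metis qinner_rscaleQ_left rscaleQ_of_real qcnj_of_real scaleR_conv_of_real)

lemma qinner_self: "qinner x x = of_real ((norm x)\<^sup>2)"
proof -
  have "qcnj (qinner x x) = qinner x x"
    by (metis qinner_commute)
  then show ?thesis
    by (simp add: quat_eq_iff qRe_qinner power2_norm_eq_inner)
qed

lemma norm_rscaleQ: "norm (x *\<^sub>Q q) = norm x * norm q" for x :: "'a::quat_inner"
proof -
  have "(of_real ((norm (x *\<^sub>Q q))\<^sup>2) :: quat) = qcnj q * of_real ((norm x)\<^sup>2) * q"
    unfolding qinner_self[symmetric] qinner_rscaleQ_left qinner_rscaleQ_right
    by (simp add: mult.assoc)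
  also have "\<dots> = of_real ((norm x)\<^sup>2) * (qcnj q * q)"
    by (simp add: of_real_def)
  also have "\<dots> = of_real ((norm x * norm q)\<^sup>2)"
    by (simp add: qcnj_times_self power_mult_distrib)
  finally have "(norm (x *\<^sub>Q q))\<^sup>2 = (norm x * norm q)\<^sup>2"
    by (simp only: of_real_eq_iff)
  then show ?thesis
    by simp
qed

text \<open>Scaling \<open>y\<close> by the conjugate of \<open>qinner x y\<close> makes the scalar
  product real, so the real Cauchy-Schwarz inequality applies.\<close>

lemma norm_qinner_le: "norm (qinner x y) \<le> norm x * norm y" for x y :: "'a::quat_inner"
proof (cases "qinner x y = 0")
  case False
  let ?q = "qinner x y"
  have "(norm ?q)\<^sup>2 = qRe (qinner x (y *\<^sub>Q qcnj ?q))"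
    by (simp only: qinner_rscaleQ_right qcnj_times_self quat_of_real_simps)
  also have "\<dots> \<le> norm x * (norm y * norm ?q)"
    unfolding qRe_qinner using norm_cauchy_schwarz[of x "y *\<^sub>Q qcnj ?q"] by (simp add: norm_rscaleQ)
  finally have "norm ?q * norm ?q \<le> (norm x * norm y) * norm ?q"
    by (simp add: power2_eq_square mult.assoc)
  with False show ?thesis
    by (simp add: mult_le_cancel_right)
qed simp

lemma bounded_bilinear_qinner: "bounded_bilinear (qinner :: 'a::quat_inner \<Rightarrow> 'a \<Rightarrow> quat)"
  by standard (auto simp: qinner_add_left qinner_add_right qinner_scaleR_left qinner_scaleR_right
      intro!: exI[of _ 1] norm_qinner_le)

lemma rscaleQ_scaleR: "(r *\<^sub>R x) *\<^sub>Q q = r *\<^sub>R (x *\<^sub>Q q)" "x *\<^sub>Q (r *\<^sub>R q) = r *\<^sub>R (x *\<^sub>Q q)"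
proof -
  have "x *\<^sub>Q of_real r *\<^sub>Q q = x *\<^sub>Q q *\<^sub>Q of_real r"
    by (simp add: rscaleQ_mult[symmetric] of_real_def)
  then show "(r *\<^sub>R x) *\<^sub>Q q = r *\<^sub>R (x *\<^sub>Q q)"
    by (simp add: rscaleQ_of_real)
  show "x *\<^sub>Q (r *\<^sub>R q) = r *\<^sub>R (x *\<^sub>Q q)"
    by (metis mult.right_neutral mult_scaleR_right of_real_def rscaleQ_mult rscaleQ_of_real)
qed

lemma bounded_bilinear_rscaleQ: "bounded_bilinear (rscaleQ :: 'a::quat_inner \<Rightarrow> quat \<Rightarrow> 'a)"
  by standard (auto simp: rscaleQ_add_left rscaleQ_add_right rscaleQ_scaleR norm_rscaleQ
      intro!: exI[of _ 1])

interpretation qinner: bounded_bilinear "qinner :: 'a::quat_inner \<Rightarrow> 'a \<Rightarrow> quat"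
  by (rule bounded_bilinear_qinner)

interpretation rscaleQ: bounded_bilinear "rscaleQ :: 'a::quat_inner \<Rightarrow> quat \<Rightarrow> 'a"
  by (rule bounded_bilinear_rscaleQ)

lemma qinner_eq_zero_commute: "qinner x y = 0 \<longleftrightarrow> qinner y x = 0"
  by (metis qinner_commute qcnj_zero)

lemma qinner_ext_left: "(\<And>y. qinner x y = qinner x' y) \<Longrightarrow> x = x'" for x :: "'a::quat_inner"
  by (metis eq_iff_diff_eq_0 norm_eq_zero of_real_eq_0_iff power_eq_0_iff qinner.diff_left qinner_self)

lemma norm_sum_orthogonal:
  fixes v :: "'i \<Rightarrow> 'a::quat_inner"
  assumes "finite F" and "\<And>k l. k \<in> F \<Longrightarrow> l \<in> F \<Longrightarrow> k \<noteq> l \<Longrightarrow> qinner (v k) (v l) = 0"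
  shows "(norm (\<Sum>k\<in>F. v k))\<^sup>2 = (\<Sum>k\<in>F. (norm (v k))\<^sup>2)"
  by (rule norm_sum_Pythagorean)
    (use assms in \<open>auto simp: pairwise_def orthogonal_def qRe_qinner[symmetric]\<close>)

text \<open>Norms below 1 only shrink the quadratic term in
  \<open>0 \<le> |x - \<Sum> v k|^2\<close>, while the cross term stays the sum of the squared
  coefficients; so the usual expansion still works.\<close>

lemma bessel:
  fixes u :: "'i \<Rightarrow> 'a::quat_inner"
  assumes "finite F" and orth: "\<And>k l. k \<in> F \<Longrightarrow> l \<in> F \<Longrightarrow> k \<noteq> l \<Longrightarrow> qinner (u k) (u l) = 0"
    and le1: "\<And>k. k \<in> F \<Longrightarrow> norm (u k) \<le> 1"
  shows "(\<Sum>k\<in>F. (norm (qinner (u k) x))\<^sup>2) \<le> (norm x)\<^sup>2"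
proof -
  define v where "v k = u k *\<^sub>Q qinner (u k) x" for k
  have "(norm (\<Sum>k\<in>F. v k))\<^sup>2 = (\<Sum>k\<in>F. (norm (v k))\<^sup>2)"
    by (rule norm_sum_orthogonal)
      (simp_all add: assms(1) v_def qinner_rscaleQ_left qinner_rscaleQ_right orth)
  also have "\<dots> \<le> (\<Sum>k\<in>F. (norm (qinner (u k) x))\<^sup>2)"
    by (intro sum_mono power_mono) (simp_all add: v_def norm_rscaleQ le1 mult_left_le_one_le)
  finally have le: "(norm (\<Sum>k\<in>F. v k))\<^sup>2 \<le> (\<Sum>k\<in>F. (norm (qinner (u k) x))\<^sup>2)" .
  have "inner x (\<Sum>k\<in>F. v k) = (\<Sum>k\<in>F. (norm (qinner (u k) x))\<^sup>2)"
    unfolding inner_sum_right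
  proof (rule sum.cong)
    fix k
    have "inner x (v k) = qRe (qcnj (qinner (u k) x) * qinner (u k) x)"
      by (simp only: v_def qRe_qinner[symmetric] qinner_rscaleQ_right qinner_commute[of x "u k"])
    then show "inner x (v k) = (norm (qinner (u k) x))\<^sup>2"
      by (simp only: qcnj_times_self quat_of_real_simps)
  qed simp
  moreover have "0 \<le> (norm (x - (\<Sum>k\<in>F. v k)))\<^sup>2"
    by simp
  ultimately show ?thesis
    using le by (simp add: power2_norm_eq_inner inner_diff_left inner_diff_right inner_commute)
qed

section \<open>Adjoints\<close>

lemma riesz_representation:
  fixes f :: "'a::{real_inner,complete_space} \<Rightarrow> real"
  assumes "bounded_linear f"
  shows "\<exists>z. \<forall>x. f x = inner z x"
proof -
  interpret f: bounded_linear f by fact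
  obtain K where K: "0 < K" "\<And>x. norm (f x) \<le> norm x * K"
    using f.pos_bounded by blast
  \<comment> \<open>If \<open>z\<close> represents \<open>f\<close>, then
    \<open>\<phi> x = |x - z|^2 - |z|^2\<close>; hence the representing vector is sought as a
    minimizer of \<open>\<phi>\<close>.\<close>
  define \<phi> where "\<phi> x = (norm x)\<^sup>2 - 2 * f x" for x
  have lower: "- K\<^sup>2 \<le> \<phi> x" for x
  proof -
    have "2 * f x \<le> 2 * (norm x * K)"
      using K(2)[of x] by simp
    moreover have "0 \<le> (norm x - K)\<^sup>2"
      by simp
    ultimately show ?thesis
      by (simp add: \<phi>_def power2_diff)
  qed
  define m where "m = Inf (range \<phi>)"
  have bdd: "bdd_below (range \<phi>)"
    using lower by (auto intro!: bdd_belowI)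
  have m_le: "m \<le> \<phi> x" for x
    unfolding m_def using bdd by (simp add: cInf_lower)
  have "\<exists>x. \<phi> x < m + 1 / real (Suc n)" for n
    using cInf_lessD[of "range \<phi>" "m + 1 / real (Suc n)"] by (auto simp: m_def)
  then obtain x where x: "\<And>n. \<phi> (x n) < m + 1 / real (Suc n)"
    by metis
  \<comment> \<open>This is the parallelogram law, in which the linear terms of
    \<open>\<phi>\<close> cancel. It forces minimizing sequences to be Cauchy.\<close>
  have para: "(norm (a - b))\<^sup>2 = 2 * \<phi> a + 2 * \<phi> b - 4 * \<phi> ((1/2) *\<^sub>R (a + b))" for a b
    by (simp add: \<phi>_def f.add f.scaleR power_mult_distrib)
      (simp add: power2_norm_eq_inner inner_add_left inner_add_right inner_diff_left
        inner_diff_right inner_commute power_divide field_simps)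
  have close: "(norm (x k - x l))\<^sup>2 \<le> 2 / real (Suc k) + 2 / real (Suc l)" for k l
    using para[of "x k" "x l"] x[of k] x[of l] m_le[of "(1/2) *\<^sub>R (x k + x l)"] by linarith
  have "Cauchy x"
  proof (rule metric_CauchyI)
    fix e :: real assume "0 < e"
    then obtain N where N: "4 / e\<^sup>2 < real N"
      using reals_Archimedean2 by blast
    have "dist (x k) (x l) < e" if "N \<le> k" "N \<le> l" for k l
    proof -
      have "2 / real (Suc k) \<le> 2 / real (Suc N)" "2 / real (Suc l) \<le> 2 / real (Suc N)"
        using that by (auto intro!: divide_left_mono)
      then have "(norm (x k - x l))\<^sup>2 \<le> 4 / real (Suc N)"
        using close[of k l] by simp
      also have "\<dots> < e\<^sup>2"
      proof -
        have "4 / e\<^sup>2 < real (Suc N)" using N by simp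
        then show ?thesis using \<open>0 < e\<close> by (simp add: field_simps)
      qed
      finally show ?thesis
        using \<open>0 < e\<close> by (simp add: dist_norm power_less_imp_less_base)
    qed
    then show "\<exists>N. \<forall>k\<ge>N. \<forall>l\<ge>N. dist (x k) (x l) < e" by blast
  qed
  then obtain z where z: "x \<longlonglongrightarrow> z"
    using Cauchy_convergent convergent_def by blast
  have "(\<lambda>n. \<phi> (x n)) \<longlonglongrightarrow> \<phi> z"
    unfolding \<phi>_def by (intro tendsto_intros f.tendsto z)
  moreover have "(\<lambda>n. \<phi> (x n)) \<longlonglongrightarrow> m"
  proof (rule tendsto_sandwich[OF _ _ tendsto_const])
    show "(\<lambda>n. m + 1 / real (Suc n)) \<longlonglongrightarrow> m"
      using tendsto_add[OF tendsto_const lim_1_over_n[THEN LIMSEQ_Suc], of m] by simp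
    show "\<forall>\<^sub>F n in sequentially. \<phi> (x n) \<le> m + 1 / real (Suc n)"
      using x by (auto intro!: always_eventually less_imp_le)
    show "\<forall>\<^sub>F n in sequentially. m \<le> \<phi> (x n)"
      using m_le by simp
  qed
  ultimately have min: "\<phi> z \<le> \<phi> y" for y
    using LIMSEQ_unique m_le by metis
  have "f y = inner z y" for y
  proof (rule ccontr)
    assume ne: "f y \<noteq> inner z y"
    define d where "d = f y - inner z y"
    have "y \<noteq> 0" using ne by auto
    \<comment> \<open>This \<open>t\<close> minimizes \<open>t^2 |y|^2 - 2 t d\<close>, the change
      of \<open>\<phi>\<close> in direction \<open>y\<close>.\<close>
    define t where "t = d / (norm y)\<^sup>2"
    have "(norm (z + t *\<^sub>R y))\<^sup>2 = (norm z)\<^sup>2 + t\<^sup>2 * (norm y)\<^sup>2 + 2 * t * inner z y"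
      unfolding power2_norm_eq_inner
      by (simp add: inner_add_left inner_add_right inner_commute algebra_simps power2_eq_square)
    then have "\<phi> (z + t *\<^sub>R y) = \<phi> z + t\<^sup>2 * (norm y)\<^sup>2 - 2 * t * d"
      by (simp add: \<phi>_def d_def f.add f.scaleR algebra_simps)
    also have "\<dots> = \<phi> z - d\<^sup>2 / (norm y)\<^sup>2"
      using \<open>y \<noteq> 0\<close> by (simp add: t_def field_simps power2_eq_square)
    also have "\<dots> < \<phi> z"
      using \<open>y \<noteq> 0\<close> ne by (simp add: d_def)
    finally show False using min[of "z + t *\<^sub>R y"] by simp
  qed
  then show ?thesis by blast
qed

section \<open>Existence and boundedness of adjoints\<close>

lemma bounded_opsD:
  assumes "T \<in> bounded_ops"
  shows "bounded_linear T" "T (x *\<^sub>Q q) = T x *\<^sub>Q q"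
  using assms by (auto simp: bounded_ops_def)

lemma adjoint_unique:
  fixes S S' :: "'a::quat_inner \<Rightarrow> 'a"
  assumes "\<And>x y. qinner (S x) y = qinner x (T y)" "\<And>x y. qinner (S' x) y = qinner x (T y)"
  shows "S = S'"
  using assms qinner_ext_left by (metis ext)

lemma qadjoint_eqI:
  fixes S :: "'a::quat_inner \<Rightarrow> 'a"
  assumes "\<And>x y. qinner (S x) y = qinner x (T y)"
  shows "qadjoint T = S"
  unfolding qadjoint_def using assms adjoint_unique by (intro the_equality) blast+

lemma qinner_qadjoint_left:
  fixes T :: "'a::quat_hilbert \<Rightarrow> 'a"
  assumes T: "T \<in> bounded_ops"
  shows "qinner (qadjoint T x) y = qinner x (T y)"
proof -
  interpret T: bounded_linear T using T by (simp add: bounded_ops_def)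
  have "\<exists>z. \<forall>y. inner x (T y) = inner z y" for x
    using riesz_representation[OF bounded_linear_compose[OF bounded_linear_inner_right T.bounded_linear_axioms]] .
  then obtain S where S: "\<And>x y. inner x (T y) = inner (S x) y"
    by metis
  \<comment> \<open>A scalar \<open>q\<close> on the right moves into the second argument, where
    \<open>T\<close> commutes with it; thus the real identity for all \<open>y\<close> contains the
    quaternionic one.\<close>
  have "qinner (S x) y = qinner x (T y)" for x y
  proof (rule quat_eqI_Re)
    fix q
    show "qRe (qinner (S x) y * q) = qRe (qinner x (T y) * q)"
      by (simp only: qinner_rscaleQ_right[symmetric] qRe_qinner S[symmetric] bounded_opsD(2)[OF T])
  qed
  then show ?thesis
    using qadjoint_eqI[of S T] by metis
qed

lemma qinner_qadjoint_right:
  fixes T :: "'a::quat_hilbert \<Rightarrow> 'a"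
  assumes "T \<in> bounded_ops"
  shows "qinner x (qadjoint T y) = qinner (T x) y"
  by (metis assms qinner_qadjoint_left qinner_commute)

text \<open>An adjoint relation already forces additivity and homogeneity, because scalar products
  separate points. Operators that are only given by their coefficients are thus recognized as
  bounded once a norm bound is known.\<close>

lemma bounded_opsI_adjoint:
  fixes T S :: "'a::quat_inner \<Rightarrow> 'a"
  assumes adj: "\<And>x y. qinner (S x) y = qinner x (T y)" and bd: "\<And>x. norm (S x) \<le> norm x * K"
  shows "S \<in> bounded_ops"
  unfolding bounded_ops_def
proof (intro CollectI conjI allI bounded_linear_intro)
  fix x y r q
  show "S (x + y) = S x + S y"
    by (rule qinner_ext_left) (simp add: adj qinner_add_left)
  show "S (r *\<^sub>R x) = r *\<^sub>R S x"
    by (rule qinner_ext_left) (simp add: adj qinner_scaleR_left)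
  show "S (x *\<^sub>Q q) = S x *\<^sub>Q q"
    by (rule qinner_ext_left) (simp add: adj qinner_rscaleQ_left)
qed (rule bd)

lemma qadjoint_bounded_ops:
  fixes T :: "'a::quat_hilbert \<Rightarrow> 'a"
  assumes T: "T \<in> bounded_ops"
  shows "qadjoint T \<in> bounded_ops"
proof -
  obtain K where K: "0 < K" "\<And>x. norm (T x) \<le> norm x * K"
    using bounded_linear.pos_bounded[OF bounded_opsD(1)[OF T]] by blast
  show ?thesis
  proof (rule bounded_opsI_adjoint[OF qinner_qadjoint_left[OF T]])
    fix x
    let ?y = "qadjoint T x"
    have "(norm ?y)\<^sup>2 = inner x (T ?y)"
      by (simp add: power2_norm_eq_inner qRe_qinner[symmetric] qinner_qadjoint_left[OF T])
    also have "\<dots> \<le> norm x * (norm ?y * K)"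
      using norm_cauchy_schwarz[of x "T ?y"] K(2)[of ?y]
      by (meson mult_left_mono norm_ge_zero order_trans)
    finally have "norm ?y * norm ?y \<le> (norm x * K) * norm ?y"
      by (simp add: power2_eq_square mult_ac)
    then show "norm ?y \<le> norm x * K"
      using K(1) by (cases "?y = 0") (simp_all add: mult_le_cancel_right)
  qed
qed

lemma bounded_ops_comp: "S \<in> bounded_ops \<Longrightarrow> T \<in> bounded_ops \<Longrightarrow> (\<lambda>x. S (T x)) \<in> bounded_ops"
  by (auto simp: bounded_ops_def intro: bounded_linear_compose)

lemma bounded_ops_half_add: "S \<in> bounded_ops \<Longrightarrow> T \<in> bounded_ops \<Longrightarrow>
    (\<lambda>x. (1/2) *\<^sub>R (S x + T x)) \<in> bounded_ops"
  by (auto simp: bounded_ops_def rscaleQ_add_left rscaleQ_scaleR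
      intro!: bounded_linear_intros)

lemma bounded_ops_half_diff: "S \<in> bounded_ops \<Longrightarrow> T \<in> bounded_ops \<Longrightarrow>
    (\<lambda>x. (1/2) *\<^sub>R (S x - T x)) \<in> bounded_ops"
  by (auto simp: bounded_ops_def rscaleQ.diff_left rscaleQ_scaleR
      intro!: bounded_linear_intros)

section \<open>Compact operators\<close>

text \<open>Compactness in the form in which it is used: extraction of subsequences from bounded
  sequences. It makes closure under compositions and sums a matter of passing to further
  subsequences.\<close>

definition seq_compact_op :: "('a::real_normed_vector \<Rightarrow> 'b::real_normed_vector) \<Rightarrow> bool"
  where "seq_compact_op A \<longleftrightarrow> (\<forall>x::nat \<Rightarrow> 'a. bounded (range x) \<longrightarrow>
    (\<exists>r l. strict_mono r \<and> (\<lambda>n. A (x (r n))) \<longlonglongrightarrow> l))"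

lemma seq_compact_opE:
  assumes "seq_compact_op A" "bounded (range x)"
  obtains r l where "strict_mono (r :: nat \<Rightarrow> nat)" "(\<lambda>n. A (x (r n))) \<longlonglongrightarrow> l"
  using assms unfolding seq_compact_op_def by blast

lemma compact_ops_seq_compact:
  assumes "T \<in> compact_ops" shows "seq_compact_op T"
  unfolding seq_compact_op_def
proof (intro allI impI)
  fix x :: "nat \<Rightarrow> 'a" assume "bounded (range x)"
  then obtain M where M: "0 < M" "\<And>n. norm (x n) \<le> M"
    by (auto simp: bounded_pos)
  interpret T: bounded_linear T
    using assms by (simp add: compact_ops_def bounded_ops_def)
  define y where "y n = (1 / M) *\<^sub>R x n" for n
  have "y n \<in> cball 0 1" for n
    using M by (simp add: y_def)
  then have "\<forall>n. T (y n) \<in> closure (T ` cball 0 1)"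
    using closure_subset by blast
  moreover have "seq_compact (closure (T ` cball 0 1))"
    using assms by (auto simp: compact_ops_def intro: compact_imp_seq_compact)
  ultimately obtain l r where r: "strict_mono r" "((\<lambda>n. T (y n)) \<circ> r) \<longlonglongrightarrow> l"
    unfolding seq_compact_def by meson
  have "(\<lambda>n. M *\<^sub>R T (y (r n))) \<longlonglongrightarrow> M *\<^sub>R l"
    using r(2) by (auto simp: o_def intro: tendsto_intros)
  then have "(\<lambda>n. T (x (r n))) \<longlonglongrightarrow> M *\<^sub>R l"
    using M(1) by (simp add: y_def T.scaleR)
  with r(1) show "\<exists>r l. strict_mono r \<and> (\<lambda>n. T (x (r n))) \<longlonglongrightarrow> l" by blast
qed

lemma seq_compact_op_comp_left:
  fixes T :: "'a::real_normed_vector \<Rightarrow> 'b::real_normed_vector"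
  assumes "bounded_linear S" "seq_compact_op T"
  shows "seq_compact_op (\<lambda>x. S (T x))"
  unfolding seq_compact_op_def
proof (intro allI impI)
  fix x :: "nat \<Rightarrow> 'a" assume "bounded (range x)"
  then obtain r l where "strict_mono (r :: nat \<Rightarrow> nat)" "(\<lambda>n. T (x (r n))) \<longlonglongrightarrow> l"
    by (rule seq_compact_opE[OF assms(2)])
  then show "\<exists>r l. strict_mono r \<and> (\<lambda>n. S (T (x (r n)))) \<longlonglongrightarrow> l"
    using bounded_linear.tendsto[OF assms(1)] by blast
qed

lemma seq_compact_op_comp_right:
  fixes S :: "'a::real_normed_vector \<Rightarrow> 'b::real_normed_vector"
  assumes "bounded_linear S" "seq_compact_op T"
  shows "seq_compact_op (\<lambda>x. T (S x))"
  unfolding seq_compact_op_def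
proof (intro allI impI)
  fix x :: "nat \<Rightarrow> 'a" assume "bounded (range x)"
  then have "bounded (range (\<lambda>n. S (x n)))"
    using bounded_linear_image[OF _ assms(1), of "range x"] by (simp add: image_image)
  then obtain r l where "strict_mono (r :: nat \<Rightarrow> nat)" "(\<lambda>n. T (S (x (r n)))) \<longlonglongrightarrow> l"
    by (rule seq_compact_opE[OF assms(2)])
  then show "\<exists>r l. strict_mono r \<and> (\<lambda>n. T (S (x (r n)))) \<longlonglongrightarrow> l" by blast
qed

text \<open>A general continuous \<open>h\<close> covers half sums and half differences at
  once.\<close>

lemma seq_compact_op_pair:
  fixes S T :: "'a::real_normed_vector \<Rightarrow> 'a"
  assumes S: "seq_compact_op S" and T: "seq_compact_op T" and h: "continuous_on UNIV (\<lambda>(u, v). h u v)"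
  shows "seq_compact_op (\<lambda>x. h (S x) (T x))"
  unfolding seq_compact_op_def
proof (intro allI impI)
  fix x :: "nat \<Rightarrow> 'a" assume bd: "bounded (range x)"
  obtain r l where r: "strict_mono (r :: nat \<Rightarrow> nat)" "(\<lambda>n. S (x (r n))) \<longlonglongrightarrow> l"
    using seq_compact_opE[OF S bd] .
  have "bounded (range (\<lambda>n. x (r n)))"
    using bd by (rule bounded_subset) auto
  then obtain r' l' where r': "strict_mono (r' :: nat \<Rightarrow> nat)" "(\<lambda>n. T (x (r (r' n)))) \<longlonglongrightarrow> l'"
    by (rule seq_compact_opE[OF T])
  have "(\<lambda>n. S (x (r (r' n)))) \<longlonglongrightarrow> l"
    using LIMSEQ_subseq_LIMSEQ[OF r(2) r'(1)] by (simp add: o_def)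
  then have "(\<lambda>n. (S (x (r (r' n))), T (x (r (r' n))))) \<longlonglongrightarrow> (l, l')"
    using r'(2) by (rule tendsto_Pair)
  then have "(\<lambda>n. h (S (x ((r \<circ> r') n))) (T (x ((r \<circ> r') n)))) \<longlonglongrightarrow> h l l'"
    using continuous_on_tendsto_compose[OF h] by (fastforce simp: o_def)
  moreover have "strict_mono (r \<circ> r')"
    using r(1) r'(1) by (rule strict_mono_o)
  ultimately show "\<exists>r l. strict_mono r \<and> (\<lambda>n. h (S (x (r n))) (T (x (r n)))) \<longlonglongrightarrow> l" by blast
qed

text \<open>Schauder's theorem. From
  \<open>|S x|^2 = \<langle>x, T (S x)\<rangle> \<le> |x| |T (S x)|\<close> with
  \<open>S = qadjoint T\<close>, convergence of \<open>T (S x)\<close> along a subsequence makes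
  \<open>S x\<close> Cauchy along it.\<close>

lemma seq_compact_qadjoint:
  fixes T :: "'a::quat_hilbert \<Rightarrow> 'a"
  assumes T: "T \<in> bounded_ops" "seq_compact_op T"
  shows "seq_compact_op (qadjoint T)"
  unfolding seq_compact_op_def
proof (intro allI impI)
  fix x :: "nat \<Rightarrow> 'a" assume bd: "bounded (range x)"
  then obtain M where M: "0 < M" "\<And>n. norm (x n) \<le> M"
    by (auto simp: bounded_pos)
  let ?S = "qadjoint T"
  interpret S: bounded_linear ?S
    using qadjoint_bounded_ops[OF T(1)] by (rule bounded_opsD)
  interpret T: bounded_linear T
    using T(1) by (rule bounded_opsD)
  have "seq_compact_op (\<lambda>x. T (?S x))"
    by (rule seq_compact_op_comp_right[OF S.bounded_linear_axioms T(2)])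
  then obtain r l where r: "strict_mono (r :: nat \<Rightarrow> nat)" "(\<lambda>n. T (?S (x (r n)))) \<longlonglongrightarrow> l"
    using bd by (rule seq_compact_opE)
  have sq: "(norm (?S (x k) - ?S (x l)))\<^sup>2 \<le> 2 * M * norm (T (?S (x k)) - T (?S (x l)))" for k l
  proof -
    have "(norm (?S (x k - x l)))\<^sup>2 = inner (x k - x l) (T (?S (x k - x l)))"
      by (simp add: power2_norm_eq_inner qRe_qinner[symmetric] qinner_qadjoint_left[OF T(1)])
    also have "\<dots> \<le> norm (x k - x l) * norm (T (?S (x k - x l)))"
      by (rule norm_cauchy_schwarz)
    also have "\<dots> \<le> (2 * M) * norm (T (?S (x k - x l)))"
      using norm_triangle_ineq4[of "x k" "x l"] M(2)[of k] M(2)[of l]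
      by (intro mult_right_mono) auto
    finally show ?thesis by (simp add: S.diff T.diff)
  qed
  have C: "Cauchy (\<lambda>n. T (?S (x (r n))))"
    using r(2) by (rule LIMSEQ_imp_Cauchy)
  have "Cauchy (\<lambda>n. ?S (x (r n)))"
  proof (rule metric_CauchyI)
    fix e :: real assume "0 < e"
    then have "0 < e\<^sup>2 / (2 * M)" using M(1) by simp
    then obtain N where N: "\<And>k l. N \<le> k \<Longrightarrow> N \<le> l \<Longrightarrow>
        dist (T (?S (x (r k)))) (T (?S (x (r l)))) < e\<^sup>2 / (2 * M)"
      using metric_CauchyD[OF C] by blast
    have "dist (?S (x (r k))) (?S (x (r l))) < e" if "N \<le> k" "N \<le> l" for k l
    proof -
      have "(norm (?S (x (r k)) - ?S (x (r l))))\<^sup>2 < e\<^sup>2"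
        using sq[of "r k" "r l"] N[OF that] M(1) by (simp add: dist_norm field_simps)
      then show ?thesis
        using \<open>0 < e\<close> by (simp add: dist_norm power_less_imp_less_base)
    qed
    then show "\<exists>N. \<forall>k\<ge>N. \<forall>l\<ge>N. dist (?S (x (r k))) (?S (x (r l))) < e" by blast
  qed
  then show "\<exists>r l. strict_mono r \<and> (\<lambda>n. ?S (x (r n))) \<longlonglongrightarrow> l"
    using r(1) Cauchy_convergent convergent_def by blast
qed

lemma qorthonormal_norm:
  assumes "qorthonormal E" "e \<in> E" shows "norm e = 1"
proof -
  have "of_real ((norm e)\<^sup>2) = (of_real 1 :: quat)"
    using assms unfolding qorthonormal_def qinner_self[symmetric] by simp
  then have "(norm e)\<^sup>2 = 1" by (simp only: of_real_eq_iff)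
  then show ?thesis
    using power2_eq_imp_eq[of "norm e" 1] by simp
qed

text \<open>Orthogonal vectors of norm at least \<open>\<epsilon>\<close> have distance at least
  \<open>\<epsilon>\<close>, so infinitely many of them would contradict compactness.\<close>

lemma finite_large_images:
  fixes A :: "'a::quat_inner \<Rightarrow> 'a"
  assumes A: "seq_compact_op A" and E: "qorthonormal E"
    and orth: "\<And>e e'. e \<in> E \<Longrightarrow> e' \<in> E \<Longrightarrow> e \<noteq> e' \<Longrightarrow> qinner (A e) (A e') = 0"
    and "0 < \<epsilon>"
  shows "finite {e \<in> E. \<epsilon> \<le> norm (A e)}"
proof (rule ccontr)
  assume "infinite {e \<in> E. \<epsilon> \<le> norm (A e)}"
  then obtain f :: "nat \<Rightarrow> 'a" where f: "inj f" "range f \<subseteq> {e \<in> E. \<epsilon> \<le> norm (A e)}"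
    by (meson infinite_countable_subset)
  note nrm = qorthonormal_norm[OF E]
  have "bounded (range f)"
    using f(2) nrm by (intro boundedI[of _ 1]) (auto simp: image_subset_iff)
  then obtain r l where r: "strict_mono (r :: nat \<Rightarrow> nat)" "(\<lambda>n. A (f (r n))) \<longlonglongrightarrow> l"
    by (rule seq_compact_opE[OF A])
  obtain N where N: "\<And>k l. N \<le> k \<Longrightarrow> N \<le> l \<Longrightarrow> dist (A (f (r k))) (A (f (r l))) < \<epsilon>"
    using metric_CauchyD[OF LIMSEQ_imp_Cauchy[OF r(2)] \<open>0 < \<epsilon>\<close>] by blast
  let ?u = "A (f (r N))" and ?v = "A (f (r (Suc N)))"
  have "f (r N) \<noteq> f (r (Suc N))"
    using f(1) r(1) by (simp add: inj_eq strict_mono_eq)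
  moreover have "f n \<in> E" for n using f(2) by auto
  ultimately have "inner ?u ?v = 0"
    using orth[of "f (r N)" "f (r (Suc N))"] by (simp flip: qRe_qinner)
  then have "(norm (?u - ?v))\<^sup>2 = (norm ?u)\<^sup>2 + (norm ?v)\<^sup>2"
    by (simp add: power2_norm_eq_inner inner_diff_left inner_diff_right inner_commute)
  moreover have "\<epsilon> \<le> norm ?u" using f(2) by auto
  ultimately have "\<epsilon>\<^sup>2 \<le> (norm (?u - ?v))\<^sup>2"
    using \<open>0 < \<epsilon>\<close> by (smt (verit) power_mono zero_le_power2)
  then have "\<epsilon> \<le> norm (?u - ?v)"
    using power2_le_imp_le norm_ge_zero by blast
  with N[of N "Suc N"] show False by (simp add: dist_norm)
qed

section \<open>The spectral theorem for compact selfadjoint operators commuting with J\<close>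

text \<open>For unit vectors maximizing \<open>\<parallel>A x\<parallel>\<close> one gets \<open>A\<^sup>2 x - m\<^sup>2 x \<rightarrow> 0\<close>; compactness makes the
  \<open>x\<close> converge, and an eigenvector of \<open>A\<^sup>2\<close> for \<open>m\<^sup>2\<close> yields one of \<open>A\<close> for \<open>m\<close> or \<open>-m\<close>.\<close>

lemma compact_symmetric_eigenvector:
  fixes A :: "'a::real_inner \<Rightarrow> 'a"
  assumes "bounded_linear A" and sym: "\<And>x y. inner (A x) y = inner x (A y)"
    and cpt: "seq_compact_op A" and U: "subspace U" "closed U" and inv: "\<And>x. x \<in> U \<Longrightarrow> A x \<in> U"
    and x0: "x0 \<in> U" "x0 \<noteq> 0"
  shows "\<exists>x l. x \<in> U \<and> norm x = 1 \<and> A x = l *\<^sub>R x"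
proof -
  interpret A: bounded_linear A by fact
  obtain K where K: "0 < K" "\<And>x. norm (A x) \<le> norm x * K"
    using A.pos_bounded by blast
  define S where "S = {x \<in> U. norm x = 1}"
  have unit: "(1 / norm x) *\<^sub>R x \<in> S" if "x \<in> U" "x \<noteq> 0" for x
    using that U(1) by (simp add: S_def subspace_scale)
  define m where "m = Sup ((\<lambda>x. norm (A x)) ` S)"
  have bdd: "bdd_above ((\<lambda>x. norm (A x)) ` S)"
  proof (rule bdd_aboveI2)
    fix x assume "x \<in> S"
    then show "norm (A x) \<le> K" using K(2)[of x] by (simp add: S_def)
  qed
  have ne: "S \<noteq> {}" using unit x0 by blast
  have m_ge: "norm (A x) \<le> m" if "x \<in> S" for x
    unfolding m_def using bdd that by (intro cSup_upper imageI)
  have m_ge': "norm (A x) \<le> m * norm x" if "x \<in> U" for x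
  proof (cases "x = 0")
    case False
    with m_ge[OF unit[OF that]] show ?thesis
      by (simp add: A.scaleR field_simps)
  qed (simp add: A.zero)
  have m0: "0 \<le> m"
    using m_ge ne norm_ge_zero order_trans by blast
  show ?thesis
  proof (cases "m = 0")
    case True
    then have "A ((1 / norm x0) *\<^sub>R x0) = 0 *\<^sub>R ((1 / norm x0) *\<^sub>R x0)"
      using m_ge[OF unit[OF x0]] by simp
    then show ?thesis
      using unit[OF x0] unfolding S_def by blast
  next
    case False
    with m0 have "0 < m" by simp
    have "\<exists>x\<in>S. m - 1 / real (Suc n) < norm (A x)" for n
      using less_cSupD[of "(\<lambda>x. norm (A x)) ` S" "m - 1 / real (Suc n)"] ne
      by (auto simp: m_def)
    then obtain x where x: "\<And>n. x n \<in> S" "\<And>n. m - 1 / real (Suc n) < norm (A (x n))"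
      by metis
    have lim: "(\<lambda>n. norm (A (x n))) \<longlonglongrightarrow> m"
    proof (rule tendsto_sandwich)
      show "(\<lambda>n. m - 1 / real (Suc n)) \<longlonglongrightarrow> m"
        using tendsto_diff[OF tendsto_const lim_1_over_n[THEN LIMSEQ_Suc], of m] by simp
      show "\<forall>\<^sub>F n in sequentially. m - 1 / real (Suc n) \<le> norm (A (x n))"
        using x(2) by (auto intro!: always_eventually less_imp_le)
      show "\<forall>\<^sub>F n in sequentially. norm (A (x n)) \<le> m"
        using m_ge x(1) by simp
    qed (rule tendsto_const)
    \<comment> \<open>In the expanded square the cross term is \<open>|A y|^2\<close>, and
      \<open>|A (A y)| \<le> m |A y|\<close> since \<open>A y\<close> lies in \<open>U\<close>. The
      right-hand side vanishes in the limit along a maximizing sequence.\<close>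
    have est: "(norm (A (A y) - m\<^sup>2 *\<^sub>R y))\<^sup>2 \<le> m\<^sup>2 * (m\<^sup>2 - (norm (A y))\<^sup>2)" if "y \<in> S" for y
    proof -
      have y: "y \<in> U" "norm y = 1" using that by (auto simp: S_def)
      have "norm (A (A y)) \<le> m * norm (A y)"
        by (rule m_ge'[OF inv[OF y(1)]])
      then have "(norm (A (A y)))\<^sup>2 \<le> m\<^sup>2 * (norm (A y))\<^sup>2"
        by (metis norm_ge_zero power_mono power_mult_distrib)
      moreover have "inner (A (A y)) y = (norm (A y))\<^sup>2"
        by (simp add: sym power2_norm_eq_inner)
      moreover have "(norm (A (A y) - m\<^sup>2 *\<^sub>R y))\<^sup>2
          = (norm (A (A y)))\<^sup>2 - 2 * m\<^sup>2 * inner (A (A y)) y + m\<^sup>2 * m\<^sup>2 * (norm y)\<^sup>2"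
        by (simp add: power2_norm_eq_inner inner_diff_left inner_diff_right inner_commute)
      ultimately show ?thesis using y(2) by (simp add: algebra_simps)
    qed
    have "(\<lambda>n. (norm (A (A (x n)) - m\<^sup>2 *\<^sub>R x n))\<^sup>2) \<longlonglongrightarrow> 0"
    proof (rule tendsto_sandwich[OF _ _ tendsto_const])
      have "(\<lambda>n. m\<^sup>2 * (m\<^sup>2 - (norm (A (x n)))\<^sup>2)) \<longlonglongrightarrow> m\<^sup>2 * (m\<^sup>2 - m\<^sup>2)"
        by (intro tendsto_intros lim)
      then show "(\<lambda>n. m\<^sup>2 * (m\<^sup>2 - (norm (A (x n)))\<^sup>2)) \<longlonglongrightarrow> 0" by simp
    qed (use est x(1) in auto)
    then have "(\<lambda>n. sqrt ((norm (A (A (x n)) - m\<^sup>2 *\<^sub>R x n))\<^sup>2)) \<longlonglongrightarrow> sqrt 0"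
      by (rule tendsto_real_sqrt)
    then have diff: "(\<lambda>n. A (A (x n)) - m\<^sup>2 *\<^sub>R x n) \<longlonglongrightarrow> 0"
      by (simp add: tendsto_norm_zero_iff)
    have "bounded (range x)"
      using x(1) by (intro boundedI[of _ 1]) (auto simp: S_def)
    then obtain r l where r: "strict_mono (r :: nat \<Rightarrow> nat)" "(\<lambda>n. A (x (r n))) \<longlonglongrightarrow> l"
      by (rule seq_compact_opE[OF cpt])
    \<comment> \<open>The vectors \<open>m\<^sup>2 *\<^sub>R x (r n)\<close> and
      \<open>A (A (x (r n)))\<close> have the same limit \<open>A l\<close>, which determines the
      limit of \<open>x (r n)\<close>.\<close>
    define z where "z = (1 / m\<^sup>2) *\<^sub>R A l"
    have "(\<lambda>n. A (A (x (r n))) - m\<^sup>2 *\<^sub>R x (r n)) \<longlonglongrightarrow> 0"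
      using LIMSEQ_subseq_LIMSEQ[OF diff r(1)] by (simp add: o_def)
    from tendsto_diff[OF A.tendsto[OF r(2)] this]
    have "(\<lambda>n. m\<^sup>2 *\<^sub>R x (r n)) \<longlonglongrightarrow> A l" by simp
    then have "(\<lambda>n. (1 / m\<^sup>2) *\<^sub>R m\<^sup>2 *\<^sub>R x (r n)) \<longlonglongrightarrow> z"
      unfolding z_def by (intro tendsto_intros)
    then have xz: "(\<lambda>n. x (r n)) \<longlonglongrightarrow> z"
      using False by simp
    have zU: "z \<in> U"
      using closed_sequentially[OF U(2) _ xz] x(1) by (auto simp: S_def)
    have nz: "norm z = 1"
    proof (rule LIMSEQ_unique[OF tendsto_norm[OF xz]])
      show "(\<lambda>n. norm (x (r n))) \<longlonglongrightarrow> 1" using x(1) by (simp add: S_def)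
    qed
    have "A z = l"
      using LIMSEQ_unique[OF A.tendsto[OF xz] r(2)] .
    then have AA: "A (A z) = m\<^sup>2 *\<^sub>R z"
      using False by (simp add: z_def)
    \<comment> \<open>This uses the factorization \<open>(A - m) (A + m) z = 0\<close>: either
      \<open>w = (A + m) z\<close> vanishes or it is an eigenvector for \<open>m\<close>.\<close>
    define w where "w = A z + m *\<^sub>R z"
    show ?thesis
    proof (cases "w = 0")
      case True
      then have "A z = (- m) *\<^sub>R z" by (simp add: w_def eq_neg_iff_add_eq_0)
      with zU nz show ?thesis by blast
    next
      case w0: False
      have "A w = m *\<^sub>R w"
        by (simp add: w_def A.add A.scaleR AA algebra_simps power2_eq_square)
      then have "A ((1 / norm w) *\<^sub>R w) = m *\<^sub>R ((1 / norm w) *\<^sub>R w)"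
        by (simp add: A.scaleR)
      moreover have "w \<in> U"
        using zU inv U(1) by (auto simp: w_def intro: subspace_add subspace_scale)
      ultimately show ?thesis
        using unit[OF _ w0] unfolding S_def by blast
    qed
  qed
qed

text \<open>A trivial orthogonal complement is what maximality in Zorn's lemma yields directly;
  convergent expansions follow from it in \<open>onb_expansion\<close>.\<close>

definition total_set :: "'a::quat_inner set \<Rightarrow> bool"
  where "total_set E \<longleftrightarrow> (\<forall>x. (\<forall>e\<in>E. qinner e x = 0) \<longrightarrow> x = 0)"

lemma total_set_eqI:
  assumes "total_set E" "\<And>e. e \<in> E \<Longrightarrow> qinner e x = qinner e y" shows "x = y"
  using assms unfolding total_set_def
  by (metis eq_iff_diff_eq_0 qinner.diff_right)

section \<open>The complex structure and its plus space\<close>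

lemma imag_unit_square: "i \<in> imag_units \<Longrightarrow> i * i = - 1"
  using quat_norm_sq[of i] by (auto simp: imag_units_def quat_eq_iff power2_eq_square)

text \<open>Imaginary quaternions that are orthogonal as vectors of three-space anticommute. The
  witness is \<open>i\<close> projected to its first two coordinates and turned by a right angle,
  unless this projection is 0.\<close>

lemma imag_unit_anticommuting:
  fixes i :: quat
  assumes "i \<in> imag_units"
  obtains j where "j \<noteq> 0" "i * j = - (j * i)"
proof (cases "qIm1 i = 0 \<and> qIm2 i = 0")
  case True
  then show ?thesis
    using assms by (intro that[of "Quat 0 1 0 0"]) (auto simp: imag_units_def quat_eq_iff)
next
  case False
  then show ?thesis
    using assms by (intro that[of "Quat 0 (qIm2 i) (- qIm1 i) 0"])
      (auto simp: imag_units_def quat_eq_iff)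
qed

locale complex_structure =
  fixes J :: "'h::quat_hilbert \<Rightarrow> 'h" and i :: quat
  assumes J: "J \<in> bounded_ops" "anti_selfadjoint J" "unitary J" and i: "i \<in> imag_units"
begin

sublocale J: bounded_linear J
  using J(1) by (rule bounded_opsD)

lemma J_skew: "qinner (J x) y = - qinner x (J y)"
proof -
  have "qinner (- J x) y = qinner x (J y)"
    using qinner_qadjoint_left[OF J(1), of x y] J(2) by (simp add: anti_selfadjoint_def)
  then show ?thesis by (simp add: qinner.minus_left minus_equation_iff)
qed

lemma J_J: "J (J x) = - x"
proof -
  have "(qadjoint J \<circ> J) x = x" using J(3) by (simp add: unitary_def)
  then show ?thesis using J(2) by (simp add: anti_selfadjoint_def minus_equation_iff)
qed

lemma J_Q: "J (x *\<^sub>Q q) = J x *\<^sub>Q q"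
  by (rule bounded_opsD(2)[OF J(1)])

lemma subspace_plus_space: "subspace (plus_space J i)"
  by (auto simp: subspace_def plus_space_def J.zero J.add J.scaleR rscaleQ_add_left rscaleQ_scaleR
      rscaleQ.zero_left)

lemma closed_plus_space: "closed (plus_space J i)"
  unfolding plus_space_def
  by (intro closed_Collect_eq continuous_intros J.continuous_on rscaleQ.continuous_on)

text \<open>The vector \<open>x\<close> is half the sum of \<open>y\<close>, in the plus space, and
  \<open>z\<close>, with \<open>J z = - (z *\<^sub>Q i)\<close>. A unit \<open>j\<close>
  anticommuting with \<open>i\<close> rotates \<open>z\<close> into the plus space, and
  \<open>y\<close>, \<open>z\<close> cannot both vanish.\<close>

lemma plus_space_reaches:
  assumes W: "subspace W" "\<And>x. x \<in> W \<Longrightarrow> J x \<in> W" "\<And>x q. x \<in> W \<Longrightarrow> x *\<^sub>Q q \<in> W"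
    and x: "x \<in> W" "x \<noteq> 0"
  shows "\<exists>y\<in>W \<inter> plus_space J i. y \<noteq> 0"
proof -
  define y z where "y = x - J x *\<^sub>Q i" and "z = x + J x *\<^sub>Q i"
  have W': "y \<in> W" "z \<in> W"
    using W x(1) by (auto simp: y_def z_def intro!: subspace_add subspace_diff)
  have ii: "v *\<^sub>Q i *\<^sub>Q i = - v" for v :: 'h
    using rscaleQ_mult[of v i i] by (simp add: imag_unit_square[OF i] rscaleQ.minus_right rscaleQ_one)
  have "y \<in> plus_space J i"
    by (simp add: plus_space_def y_def J.diff J_Q J_J rscaleQ.diff_left ii rscaleQ.minus_left)
  moreover have Jz: "J z = - (z *\<^sub>Q i)"
    by (simp add: z_def J.add J_Q J_J rscaleQ_add_left ii rscaleQ.minus_left)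
  obtain j where j: "j \<noteq> 0" "i * j = - (j * i)"
    using imag_unit_anticommuting[OF i] .
  have "J (z *\<^sub>Q j) = z *\<^sub>Q j *\<^sub>Q i"
    by (simp add: J_Q Jz rscaleQ.minus_left rscaleQ.minus_right j(2) flip: rscaleQ_mult)
  then have "z *\<^sub>Q j \<in> plus_space J i"
    by (simp add: plus_space_def)
  moreover have "y \<noteq> 0 \<or> z \<noteq> 0"
  proof (rule ccontr)
    assume "\<not> (y \<noteq> 0 \<or> z \<noteq> 0)"
    then have "x + x = 0" by (simp add: y_def z_def)
    with x(2) show False by (simp flip: scaleR_2)
  qed
  moreover have "z *\<^sub>Q j = 0 \<longleftrightarrow> z = 0"
    using j(1) norm_rscaleQ[of z j] by (metis mult_eq_0_iff norm_eq_zero)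
  ultimately show ?thesis
    using W' W(3) by blast
qed

text \<open>Take a maximal orthonormal set of eigenvectors in the plus space. Its orthogonal
  complement \<open>W\<close> is stable under \<open>J\<close> and under right scalars, so a nonzero
  \<open>W\<close> meets the plus space nontrivially. The intersection is a closed real subspace
  invariant under \<open>A\<close>; an eigenvector found there contradicts maximality.\<close>

theorem spectral_theorem:
  fixes A :: "'h \<Rightarrow> 'h"
  assumes A: "A \<in> bounded_ops" "seq_compact_op A" and sym: "\<And>x y. qinner (A x) y = qinner x (A y)"
    and AJ: "\<And>x. A (J x) = J (A x)"
  shows "\<exists>E. qorthonormal E \<and> E \<subseteq> plus_space J i \<and> total_set E \<and> (\<forall>e\<in>E. \<exists>l::real. A e = l *\<^sub>R e)"
proof -
  interpret A: bounded_linear A using A(1) by (rule bounded_opsD)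
  have symR: "inner (A x) y = inner x (A y)" for x y
    by (simp add: sym flip: qRe_qinner)
  define \<E> where "\<E> = {E. qorthonormal E \<and> E \<subseteq> plus_space J i \<and> (\<forall>e\<in>E. \<exists>l::real. A e = l *\<^sub>R e)}"
  have "\<exists>M\<in>\<E>. \<forall>X\<in>\<E>. M \<subseteq> X \<longrightarrow> X = M"
  proof (rule subset_Zorn')
    fix C assume C: "subset.chain \<E> C"
    have "qinner x y = (if x = y then 1 else 0)" if xy: "x \<in> \<Union>C" "y \<in> \<Union>C" for x y
    proof -
      obtain X where "x \<in> X" "X \<in> C" using xy(1) by (rule UnionE)
      moreover obtain Y where "y \<in> Y" "Y \<in> C" using xy(2) by (rule UnionE)
      moreover have "X \<subseteq> Y \<or> Y \<subseteq> X"
        using C \<open>X \<in> C\<close> \<open>Y \<in> C\<close> unfolding subset_chain_def by blast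
      ultimately obtain Z where "x \<in> Z" "y \<in> Z" "Z \<in> C" by (elim disjE) (blast dest: subsetD)+
      moreover have "Z \<in> \<E>" using \<open>Z \<in> C\<close> C by (auto simp: subset_chain_def)
      ultimately show ?thesis by (auto simp: \<E>_def qorthonormal_def)
    qed
    then have "qorthonormal (\<Union>C)" by (simp add: qorthonormal_def)
    moreover have "X \<in> \<E>" if "X \<in> C" for X using that C by (auto simp: subset_chain_def)
    ultimately show "\<Union>C \<in> \<E>" unfolding \<E>_def by blast
  qed
  then obtain E where E: "E \<in> \<E>" and max: "\<And>X. X \<in> \<E> \<Longrightarrow> E \<subseteq> X \<Longrightarrow> X = E" by blast
  have "total_set E"
  proof (rule ccontr)
    assume "\<not> total_set E"
    then obtain x where x: "\<And>e. e \<in> E \<Longrightarrow> qinner e x = 0" "x \<noteq> 0"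
      by (auto simp: total_set_def)
    define W where "W = {x. \<forall>e\<in>E. qinner e x = 0}"
    have sub: "subspace W"
      by (auto simp: W_def subspace_def qinner_add_right qinner_scaleR_right qinner.zero_right)
    have "J y \<in> W" if "y \<in> W" for y
    proof -
      have "qinner e (J y) = 0" if "e \<in> E" for e
      proof -
        have "J e = e *\<^sub>Q i" using that E by (auto simp: \<E>_def plus_space_def)
        then have "qinner (J e) y = 0"
          using that \<open>y \<in> W\<close> by (simp add: qinner_rscaleQ_left W_def)
        then show ?thesis by (simp add: J_skew)
      qed
      then show ?thesis by (simp add: W_def)
    qed
    moreover have "y *\<^sub>Q q \<in> W" if "y \<in> W" for y q
      using that by (simp add: W_def qinner_rscaleQ_right)
    ultimately obtain y where y: "y \<in> W \<inter> plus_space J i" "y \<noteq> 0"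
      using plus_space_reaches[OF sub, of x] x by (auto simp: W_def)
    have clW: "closed W"
    proof -
      have "W = (\<Inter>e\<in>E. {x. qinner e x = 0})" by (auto simp: W_def)
      also have "closed \<dots>"
        by (intro closed_INT ballI closed_Collect_eq continuous_intros qinner.continuous_on)
      finally show ?thesis .
    qed
    have "\<exists>u l. u \<in> W \<inter> plus_space J i \<and> norm u = 1 \<and> A u = l *\<^sub>R u"
    proof (rule compact_symmetric_eigenvector[OF A.bounded_linear_axioms symR A(2) _ _ _ y])
      show "subspace (W \<inter> plus_space J i)"
        using sub subspace_plus_space by (rule subspace_inter)
      show "closed (W \<inter> plus_space J i)"
        using clW closed_plus_space by (rule closed_Int)
      fix v assume v: "v \<in> W \<inter> plus_space J i"
      have "qinner e (A v) = 0" if e: "e \<in> E" for e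
      proof -
        obtain l :: real where "A e = l *\<^sub>R e" using e E by (auto simp: \<E>_def)
        with v e show ?thesis
          by (simp add: sym[symmetric] qinner_scaleR_left W_def)
      qed
      moreover have "J (A v) = A v *\<^sub>Q i"
        using v by (simp add: plus_space_def bounded_opsD(2)[OF A(1)] flip: AJ)
      ultimately show "A v \<in> W \<inter> plus_space J i" by (simp add: W_def plus_space_def)
    qed
    then obtain u l where u: "u \<in> W" "u \<in> plus_space J i" "norm u = 1" "A u = l *\<^sub>R u" by blast
    have uu: "qinner u u = 1" by (simp add: qinner_self u(3))
    have ue: "qinner u e = 0" "qinner e u = 0" if "e \<in> E" for e
      using u(1) that by (auto simp: W_def qinner_eq_zero_commute[of u])
    have "qorthonormal (insert u E)"
      using E uu ue unfolding \<E>_def qorthonormal_def by auto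
    then have "insert u E \<in> \<E>"
      using E u(2,4) unfolding \<E>_def by blast
    then have "u \<in> E" using max[of "insert u E"] by blast
    then show False using ue(1)[of u] uu by simp
  qed
  with E show ?thesis by (auto simp: \<E>_def)
qed

end

text \<open>Such a set consists of eigenvectors of \<open>T\<^sup>* T\<close>, the eigenvalue at \<open>e\<close> being \<open>\<parallel>T e\<parallel>\<^sup>2\<close>.\<close>

definition singular_basis :: "('a::quat_inner \<Rightarrow> 'a) \<Rightarrow> 'a set \<Rightarrow> bool"
  where "singular_basis T E \<longleftrightarrow> qorthonormal E \<and> total_set E \<and>
    (\<forall>e\<in>E. \<forall>e'\<in>E. e \<noteq> e' \<longrightarrow> qinner (T e) (T e') = 0)"

lemma singular_basis_selfadjoint:
  assumes "qorthonormal E" "total_set E" "\<And>e. e \<in> E \<Longrightarrow> \<exists>l::real. A e = l *\<^sub>R e"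
  shows "singular_basis A E"
  unfolding singular_basis_def
proof (intro conjI ballI impI assms)
  fix e e' assume e: "e \<in> E" "e' \<in> E" "e \<noteq> e'"
  obtain l l' :: real where "A e = l *\<^sub>R e" "A e' = l' *\<^sub>R e'" using assms(3) e by metis
  then show "qinner (A e) (A e') = 0"
    using e assms(1) by (simp add: qinner_scaleR_left qinner_scaleR_right qorthonormal_def)
qed

context complex_structure
begin

lemma qadjoint_J_commute:
  assumes T: "T \<in> bounded_ops" and TJ: "\<And>x. T (J x) = J (T x)"
  shows "qadjoint T (J x) = J (qadjoint T x)"
proof (rule qinner_ext_left)
  fix y
  show "qinner (qadjoint T (J x)) y = qinner (J (qadjoint T x)) y"
    by (simp add: qinner_qadjoint_left[OF T] J_skew flip: TJ)
qed

lemma singular_basis_exists: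
  assumes T: "T \<in> bounded_ops" "seq_compact_op T" and TJ: "\<And>x. T (J x) = J (T x)"
  shows "\<exists>E. singular_basis T E \<and> E \<subseteq> plus_space J i"
proof -
  have S: "qadjoint T \<in> bounded_ops" by (rule qadjoint_bounded_ops[OF T(1)])
  have "\<exists>E. qorthonormal E \<and> E \<subseteq> plus_space J i \<and> total_set E \<and>
      (\<forall>e\<in>E. \<exists>l::real. qadjoint T (T e) = l *\<^sub>R e)"
  proof (rule spectral_theorem)
    show "(\<lambda>x. qadjoint T (T x)) \<in> bounded_ops" using S T(1) by (rule bounded_ops_comp)
    show "seq_compact_op (\<lambda>x. qadjoint T (T x))"
      using bounded_opsD(1)[OF S] T(2) by (rule seq_compact_op_comp_left)
    show "qinner (qadjoint T (T x)) y = qinner x (qadjoint T (T y))" for x y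
      by (simp add: qinner_qadjoint_left[OF T(1)] qinner_qadjoint_right[OF T(1)])
    show "qadjoint T (T (J x)) = J (qadjoint T (T x))" for x
      by (simp add: TJ qadjoint_J_commute[OF T(1) TJ])
  qed
  then obtain E where E: "qorthonormal E" "E \<subseteq> plus_space J i" "total_set E"
    and eig: "\<And>e. e \<in> E \<Longrightarrow> \<exists>l::real. qadjoint T (T e) = l *\<^sub>R e" by blast
  have "qinner (T e) (T e') = 0" if e: "e \<in> E" "e' \<in> E" "e \<noteq> e'" for e e'
  proof -
    obtain l :: real where "qadjoint T (T e) = l *\<^sub>R e" using eig e by blast
    then have "qinner (T e) (T e') = l *\<^sub>R qinner e e'"
      by (metis qinner_qadjoint_left[OF T(1)] qinner_scaleR_left)
    then show ?thesis using e E(1) by (simp add: qorthonormal_def)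
  qed
  with E show ?thesis unfolding singular_basis_def by blast
qed

lemma commute_plus_space:
  assumes T: "T \<in> bounded_ops" and TJ: "\<And>x. T (J x) = J (T x)" and "x \<in> plus_space J i"
  shows "T x \<in> plus_space J i"
  using assms(3) by (simp add: plus_space_def bounded_opsD(2)[OF T] flip: TJ)

end

lemma singular_basis_gram:
  assumes "singular_basis T E" "e \<in> E" "e' \<in> E"
  shows "qinner (T e) (T e') = of_real (if e = e' then (norm (T e))\<^sup>2 else 0)"
  using assms by (auto simp: singular_basis_def qinner_self)

section \<open>Orthonormal expansions\<close>

text \<open>By Pythagoras, differences of nested partial sums have squared norms equal to
  differences of partial sums of the squares; completeness does the rest.\<close>

lemma orthogonal_summable:
  fixes v :: "'i \<Rightarrow> 'a::quat_hilbert"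
  assumes orth: "\<And>k l. k \<in> A \<Longrightarrow> l \<in> A \<Longrightarrow> k \<noteq> l \<Longrightarrow> qinner (v k) (v l) = 0"
    and sq: "(\<lambda>k. (norm (v k))\<^sup>2) summable_on A"
  shows "v summable_on A"
proof -
  define S where "S F = (\<Sum>k\<in>F. (norm (v k))\<^sup>2)" for F
  obtain L where L: "(S \<longlongrightarrow> L) (finite_subsets_at_top A)"
    using sq unfolding summable_on_def has_sum_def S_def[abs_def] by blast
  have "\<exists>P. eventually P (finite_subsets_at_top A) \<and>
      (\<forall>F F'. P F \<and> P F' \<longrightarrow> dist (sum v F) (sum v F') < e)" if "0 < e" for e
  proof -
    \<comment> \<open>Two values within \<open>e\<^sup>2 / 8\<close> of \<open>L\<close> differ by
      less than \<open>(e / 2)\<^sup>2\<close>, which bounds nested differences by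
      \<open>e / 2\<close>. Comparing two arbitrary sets through their union costs this
      twice.\<close>
    have "eventually (\<lambda>F. dist (S F) L < e\<^sup>2 / 8) (finite_subsets_at_top A)"
      by (rule tendstoD[OF L]) (use \<open>0 < e\<close> in simp)
    then obtain F0 where F0: "finite F0" "F0 \<subseteq> A"
      "\<And>F. finite F \<Longrightarrow> F0 \<subseteq> F \<Longrightarrow> F \<subseteq> A \<Longrightarrow> dist (S F) L < e\<^sup>2 / 8"
      by (auto simp: eventually_finite_subsets_at_top)
    define P where "P F \<longleftrightarrow> finite F \<and> F \<subseteq> A \<and> F0 \<subseteq> F" for F
    have "eventually P (finite_subsets_at_top A)"
      using F0 by (auto simp: eventually_finite_subsets_at_top P_def)
    moreover have half: "dist (sum v G) (sum v F) < e / 2" if "P F" "P G" "F \<subseteq> G" for F G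
    proof -
      have fin: "finite G" "finite F" using that by (auto simp: P_def)
      have "(norm (sum v (G - F)))\<^sup>2 = S (G - F)"
        unfolding S_def using fin that orth
        by (intro norm_sum_orthogonal) (auto simp: P_def subset_iff)
      also have "\<dots> = S G - S F"
        unfolding S_def using fin that(3) by (simp add: sum_diff)
      also have "\<dots> < (e / 2)\<^sup>2"
        using F0(3)[of F] F0(3)[of G] that
        by (simp add: P_def dist_real_def power_divide abs_if split: if_splits)
      finally have "norm (sum v (G - F)) < e / 2"
        by (rule power_less_imp_less_base) (use \<open>0 < e\<close> in simp)
      then show ?thesis
        using fin that(3) by (simp add: dist_norm sum_diff)
    qed
    have "dist (sum v F) (sum v F') < e" if "P F" "P F'" for F F'
    proof -
      have "P (F \<union> F')" using that by (auto simp: P_def)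
      then have "dist (sum v (F \<union> F')) (sum v F) < e / 2" "dist (sum v (F \<union> F')) (sum v F') < e / 2"
        using half that by simp_all
      then show ?thesis
        using dist_triangle3[of "sum v F" "sum v F'" "sum v (F \<union> F')"] by linarith
    qed
    ultimately show ?thesis by blast
  qed
  then have "cauchy_filter (filtermap (sum v) (finite_subsets_at_top A))"
    by (simp add: cauchy_filter_metric_filtermap)
  moreover have "complete (UNIV :: 'a set)"
    by (meson Cauchy_convergent UNIV_I complete_def convergent_def)
  ultimately obtain L' where "(sum v \<longlongrightarrow> L') (finite_subsets_at_top A)"
    using complete_uniform[where S = UNIV] by (force simp: filterlim_def)
  then show ?thesis
    using summable_on_def has_sum_def by blast
qed

text \<open>A Riesz-Fischer statement with square summability expressed by comparison with the
  coefficients of a vector \<open>x\<close>, as Bessel's inequality supplies it. It serves for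
  expansions (\<open>K = 1\<close>) and for diagonal operators.\<close>

lemma onb_combination:
  fixes E :: "'a::quat_hilbert set"
  assumes E: "qorthonormal E" and le: "\<And>e. e \<in> E \<Longrightarrow> norm (c e) \<le> K * norm (qinner e x)"
  shows "\<exists>y. ((\<lambda>e. e *\<^sub>Q c e) has_sum y) E \<and> (\<forall>e\<in>E. qinner e y = c e)"
proof -
  have nrm: "norm (e *\<^sub>Q c e) = norm (c e)" if "e \<in> E" for e
    using qorthonormal_norm[OF E that] by (simp add: norm_rscaleQ)
  have "(\<lambda>e. (norm (e *\<^sub>Q c e))\<^sup>2) summable_on E"
  proof (rule nonneg_bdd_above_summable_on)
    show "bdd_above (sum (\<lambda>e. (norm (e *\<^sub>Q c e))\<^sup>2) ` {F. F \<subseteq> E \<and> finite F})"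
    proof (rule bdd_aboveI2)
      fix F assume "F \<in> {F. F \<subseteq> E \<and> finite F}"
      then have F: "F \<subseteq> E" "finite F" by auto
      have "(\<Sum>e\<in>F. (norm (e *\<^sub>Q c e))\<^sup>2) \<le> (\<Sum>e\<in>F. K\<^sup>2 * (norm (qinner e x))\<^sup>2)"
      proof (rule sum_mono)
        fix e assume "e \<in> F"
        then have "e \<in> E" using F by blast
        then show "(norm (e *\<^sub>Q c e))\<^sup>2 \<le> K\<^sup>2 * (norm (qinner e x))\<^sup>2"
          using power_mono[OF le, of e 2] by (simp add: nrm power_mult_distrib)
      qed
      also have "\<dots> = K\<^sup>2 * (\<Sum>e\<in>F. (norm (qinner e x))\<^sup>2)"
        by (simp add: sum_distrib_left)
      also have "\<dots> \<le> K\<^sup>2 * (norm x)\<^sup>2"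
      proof (intro mult_left_mono bessel)
        show "norm e \<le> 1" if "e \<in> F" for e
          using qorthonormal_norm[OF E] F that by (simp add: subset_iff)
        show "qinner e e' = 0" if "e \<in> F" "e' \<in> F" "e \<noteq> e'" for e e'
          using E F that by (auto simp: qorthonormal_def subset_iff)
      qed (use F in simp_all)
      finally show "(\<Sum>e\<in>F. (norm (e *\<^sub>Q c e))\<^sup>2) \<le> K\<^sup>2 * (norm x)\<^sup>2" .
    qed
  qed simp
  then have "(\<lambda>e. e *\<^sub>Q c e) summable_on E"
    using E by (intro orthogonal_summable)
      (simp_all add: qinner_rscaleQ_left qinner_rscaleQ_right qorthonormal_def)
  then obtain y where y: "((\<lambda>e. e *\<^sub>Q c e) has_sum y) E"
    by (auto simp: summable_on_def)
  have "qinner e y = c e" if "e \<in> E" for e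
  proof -
    have "((\<lambda>e'. qinner e (e' *\<^sub>Q c e')) has_sum qinner e y) E"
      by (rule has_sum_bounded_linear[OF qinner.bounded_linear_right y])
    moreover have "((\<lambda>e'. qinner e (e' *\<^sub>Q c e')) has_sum c e) E"
      by (rule has_sum_finite_neutralI[of "{e}"])
        (use E that in \<open>auto simp: qorthonormal_def qinner_rscaleQ_right\<close>)
    ultimately show ?thesis by (rule has_sum_unique)
  qed
  with y show ?thesis by blast
qed

lemma onb_expansion:
  fixes E :: "'a::quat_hilbert set"
  assumes "qorthonormal E" "total_set E"
  shows "((\<lambda>e. e *\<^sub>Q qinner e x) has_sum x) E"
proof -
  obtain y where y: "((\<lambda>e. e *\<^sub>Q qinner e x) has_sum y) E" "\<forall>e\<in>E. qinner e y = qinner e x"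
    using onb_combination[OF assms(1), of "\<lambda>e. qinner e x" 1 x] by auto
  then have "y = x" using total_set_eqI[OF assms(2)] by blast
  with y show ?thesis by simp
qed

lemma onb_parseval:
  fixes E :: "'a::quat_hilbert set"
  assumes "qorthonormal E" "total_set E"
  shows "((\<lambda>e. qinner x e * qinner e y) has_sum qinner x y) E"
  using has_sum_bounded_linear[OF qinner.bounded_linear_right[of x] onb_expansion[OF assms, of y]]
  by (simp add: qinner_rscaleQ_right)

section \<open>The modulus of an operator\<close>

lemma singular_basis_eigenvector:
  fixes T :: "'a::quat_hilbert \<Rightarrow> 'a"
  assumes T: "T \<in> bounded_ops" and E: "singular_basis T E" and e: "e \<in> E"
  shows "qadjoint T (T e) = (norm (T e))\<^sup>2 *\<^sub>R e"
proof (rule total_set_eqI)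
  show "total_set E" using E by (simp add: singular_basis_def)
  fix e' assume "e' \<in> E"
  then show "qinner e' (qadjoint T (T e)) = qinner e' ((norm (T e))\<^sup>2 *\<^sub>R e)"
    using E e by (auto simp: qinner_qadjoint_right[OF T] qinner_scaleR_right singular_basis_gram[OF E]
        singular_basis_def qorthonormal_def of_real_def)
qed

text \<open>\<open>P\<close> is the diagonal operator with entries \<open>|T e|\<close> along
  \<open>E\<close>. Symmetry and positivity are checked coefficientwise through Parseval's
  identity.\<close>

lemma modulus_exists:
  fixes T :: "'a::quat_hilbert \<Rightarrow> 'a"
  assumes T: "T \<in> bounded_ops" and E: "singular_basis T E"
  obtains P where "P \<in> bounded_ops" "positive_op P" "P \<circ> P = qadjoint T \<circ> T"
    "\<And>x y. qinner (P x) y = qinner x (P y)" "\<And>e. e \<in> E \<Longrightarrow> P e = norm (T e) *\<^sub>R e"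
proof -
  have on: "qorthonormal E" and tot: "total_set E" using E by (auto simp: singular_basis_def)
  obtain K where K: "\<And>x. norm (T x) \<le> norm x * K"
    using bounded_linear.bounded[OF bounded_opsD(1)[OF T]] by blast
  have "\<exists>y. \<forall>e\<in>E. qinner e y = norm (T e) *\<^sub>R qinner e x" for x
  proof -
    have "norm (norm (T e) *\<^sub>R qinner e x) \<le> K * norm (qinner e x)" if "e \<in> E" for e
      using K[of e] qorthonormal_norm[OF on that] by (simp add: mult_right_mono)
    from onb_combination[OF on this] show ?thesis by blast
  qed
  then obtain P where P: "\<And>x e. e \<in> E \<Longrightarrow> qinner e (P x) = norm (T e) *\<^sub>R qinner e x"
    by metis
  have Pl: "qinner (P x) e = norm (T e) *\<^sub>R qinner x e" if "e \<in> E" for x e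
  proof -
    have "qinner (P x) e = qcnj (norm (T e) *\<^sub>R qinner e x)"
      using P[OF that, of x] by (subst qinner_commute) simp
    also have "\<dots> = norm (T e) *\<^sub>R qcnj (qinner e x)"
      by (simp add: quat_eq_iff)
    finally show ?thesis by (simp flip: qinner_commute)
  qed
  have sym: "qinner (P x) y = qinner x (P y)" for x y
  proof (rule has_sum_unique)
    show "((\<lambda>e. qinner (P x) e * qinner e y) has_sum qinner (P x) y) E"
      by (rule onb_parseval[OF on tot])
    have "((\<lambda>e. qinner x e * qinner e (P y)) has_sum qinner x (P y)) E"
      by (rule onb_parseval[OF on tot])
    then show "((\<lambda>e. qinner (P x) e * qinner e y) has_sum qinner x (P y)) E"
      by (rule has_sum_cong[THEN iffD1, rotated]) (simp add: P Pl)
  qed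
  have PP: "P (P x) = qadjoint T (T x)" for x
  proof (rule total_set_eqI[OF tot])
    fix e assume e: "e \<in> E"
    have "qinner e (qadjoint T (T x)) = qinner (qadjoint T (T e)) x"
      by (simp add: qinner_qadjoint_left[OF T] qinner_qadjoint_right[OF T])
    then show "qinner e (P (P x)) = qinner e (qadjoint T (T x))"
      by (simp add: e P singular_basis_eigenvector[OF T E e] qinner_scaleR_left power2_eq_square)
  qed
  \<comment> \<open>Since \<open>P\<close> squared is \<open>qadjoint T\<close> after
    \<open>T\<close>, both operators have the same norm at every \<open>x\<close>; so the bound
    \<open>K\<close> of \<open>T\<close> serves for \<open>P\<close>.\<close>
  have nrm: "norm (P x) = norm (T x)" for x
  proof -
    have "qinner (P x) (P x) = qinner (T x) (T x)"
      by (simp add: sym PP qinner_qadjoint_right[OF T])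
    then show ?thesis by (simp add: qinner_self flip: of_real_power)
  qed
  have 1: "P \<in> bounded_ops"
    by (rule bounded_opsI_adjoint[OF sym, where K = K]) (simp add: nrm K)
  have 2: "positive_op P"
    unfolding positive_op_def selfadjoint_def
  proof (intro conjI allI)
    show "qadjoint P = P" by (rule qadjoint_eqI[OF sym])
    fix x
    have "qcnj (qinner x (P x)) = qinner x (P x)"
      by (metis sym qinner_commute)
    then have "qinner x (P x) = of_real (qRe (qinner x (P x)))"
      by (simp add: quat_eq_iff)
    moreover have "0 \<le> qRe (qinner x (P x))"
    proof -
      \<comment> \<open>Pairing with 1 extracts the real part as a bounded linear functional, which
        can be applied to the sum term by term.\<close>
      have "((\<lambda>e. inner 1 (qinner x e * qinner e (P x))) has_sum inner 1 (qinner x (P x))) E"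
        by (rule has_sum_bounded_linear[OF bounded_linear_inner_right onb_parseval[OF on tot]])
      moreover have "0 \<le> inner 1 (qinner x e * qinner e (P x))" if "e \<in> E" for e
      proof -
        have "qinner x e * qinner e (P x) = norm (T e) *\<^sub>R (qcnj (qinner e x) * qinner e x)"
          by (simp add: P[OF that] flip: qinner_commute)
        then show ?thesis
          by (simp add: qcnj_times_self inner_quat_def del: of_real_power)
      qed
      ultimately have "0 \<le> inner 1 (qinner x (P x))"
        by (rule has_sum_nonneg)
      then show ?thesis by (simp add: inner_quat_def)
    qed
    ultimately show "\<exists>r\<ge>0. qinner x (P x) = of_real r" by blast
  qed
  have 5: "P e = norm (T e) *\<^sub>R e" if "e \<in> E" for e
    by (rule total_set_eqI[OF tot])
      (use on that in \<open>auto simp: P qinner_scaleR_right qorthonormal_def\<close>)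
  show ?thesis
    using that[OF 1 2 _ sym 5] PP by (simp add: fun_eq_iff)
qed

text \<open>As \<open>(Q + m) (Q - m) e = 0\<close>, the vector \<open>z = (Q - m) e\<close>
  satisfies \<open>Q z = - m z\<close>, which positivity allows only for \<open>z = 0\<close> when
  \<open>m > 0\<close>. For \<open>m = 0\<close> use
  \<open>|Q e|^2 = \<langle>e, Q (Q e)\<rangle>\<close>.\<close>

lemma positive_root_on_eigenvector:
  fixes Q :: "'a::quat_hilbert \<Rightarrow> 'a"
  assumes Q: "Q \<in> bounded_ops" "positive_op Q" and e: "Q (Q e) = m\<^sup>2 *\<^sub>R e" and m: "0 \<le> m"
  shows "Q e = m *\<^sub>R e"
proof -
  interpret Q: bounded_linear Q using Q(1) by (rule bounded_opsD)
  define z where "z = Q e - m *\<^sub>R e"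
  have sym: "qinner (Q x) y = qinner x (Q y)" for x y
    using qinner_qadjoint_left[OF Q(1)] Q(2) by (simp add: positive_op_def selfadjoint_def)
  have pos: "0 \<le> inner x (Q x)" for x
    using Q(2) by (metis positive_op_def qRe_qinner quat_of_real_simps(1))
  have "Q z = - m *\<^sub>R z"
    by (simp add: z_def Q.diff Q.scaleR e algebra_simps power2_eq_square)
  then have "0 \<le> - m * (norm z)\<^sup>2"
    using pos[of z] by (simp add: power2_norm_eq_inner)
  then have *: "m * (norm z)\<^sup>2 \<le> 0" by simp
  show ?thesis
  proof (cases "m = 0")
    case True
    have "qinner (Q e) (Q e) = 0"
      by (simp add: sym e True qinner.zero_right)
    then show ?thesis using True by (simp add: qinner_self)
  next
    case False
    then have "norm z = 0"
      using * m by (simp add: mult_le_0_iff)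
    then show ?thesis by (simp add: z_def)
  qed
qed

text \<open>This resolves the definite description of the square root: every positive root agrees
  with \<open>P\<close> on \<open>E\<close>, and symmetry of both carries the agreement to the
  coefficients of all vectors.\<close>

lemma abs_op_singular_basis:
  fixes T :: "'a::quat_hilbert \<Rightarrow> 'a"
  assumes T: "T \<in> bounded_ops" and E: "singular_basis T E"
  shows "abs_op T \<in> bounded_ops" "qinner (abs_op T x) y = qinner x (abs_op T y)"
    "e \<in> E \<Longrightarrow> abs_op T e = norm (T e) *\<^sub>R e"
proof -
  have tot: "total_set E" using E by (simp add: singular_basis_def)
  obtain P where P: "P \<in> bounded_ops" "positive_op P" "P \<circ> P = qadjoint T \<circ> T"
    "\<And>x y. qinner (P x) y = qinner x (P y)" "\<And>e. e \<in> E \<Longrightarrow> P e = norm (T e) *\<^sub>R e"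
    using modulus_exists[OF T E] by blast
  have "abs_op T = P"
    unfolding abs_op_def sqrt_op_def
  proof (rule the_equality)
    fix Q assume Q: "Q \<in> bounded_ops \<and> positive_op Q \<and> Q \<circ> Q = qadjoint T \<circ> T"
    have sym: "qinner (Q x) y = qinner x (Q y)" for x y
      using qinner_qadjoint_left[of Q] Q by (simp add: positive_op_def selfadjoint_def)
    have Qe: "Q e = norm (T e) *\<^sub>R e" if "e \<in> E" for e
    proof (rule positive_root_on_eigenvector)
      show "Q (Q e) = (norm (T e))\<^sup>2 *\<^sub>R e"
        using Q singular_basis_eigenvector[OF T E that] by (metis comp_apply)
    qed (use Q in auto)
    show "Q = P"
    proof
      fix x
      show "Q x = P x"
        by (rule total_set_eqI[OF tot]) (simp add: Qe P(5) flip: sym P(4))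
    qed
  qed (use P in blast)
  then show "abs_op T \<in> bounded_ops" "qinner (abs_op T x) y = qinner x (abs_op T y)"
    "e \<in> E \<Longrightarrow> abs_op T e = norm (T e) *\<^sub>R e"
    using P by auto
qed

section \<open>Quaternionic dimension\<close>

text \<open>Invariance of dimension is reduced to the real case: multiplying the vectors of a
  quaternionic basis by the four unit quaternions gives a real basis.\<close>

definition quat_units :: "quat set"
  where "quat_units = {Quat 1 0 0 0, Quat 0 1 0 0, Quat 0 0 1 0, Quat 0 0 0 1}"

lemma card_quat_units: "finite quat_units" "card quat_units = 4"
  by (simp_all add: quat_units_def)

lemma zero_notin_quat_units: "0 \<notin> quat_units"
  by (simp add: quat_units_def zero_quat_def)

lemma sum_quat_units:
  "(\<Sum>u\<in>quat_units. r u *\<^sub>R u) = Quat (r (Quat 1 0 0 0)) (r (Quat 0 1 0 0)) (r (Quat 0 0 1 0)) (r (Quat 0 0 0 1))"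
  by (simp add: quat_units_def quat_eq_iff)

lemma quat_units_independent: "(\<Sum>u\<in>quat_units. r u *\<^sub>R u) = 0 \<Longrightarrow> u \<in> quat_units \<Longrightarrow> r u = 0"
  unfolding sum_quat_units quat_eq_iff by (auto simp: quat_units_def)

lemma quat_units_combination: "\<exists>r. q = (\<Sum>u\<in>quat_units. r u *\<^sub>R u)"
proof
  let ?r = "\<lambda>u. inner q u"
  show "q = (\<Sum>u\<in>quat_units. ?r u *\<^sub>R u)"
    by (simp add: sum_quat_units quat_eq_iff inner_quat_def)
qed

lemma qindependentD:
  assumes "qindependent B" "finite F" "F \<subseteq> B" "(\<Sum>x\<in>F. x *\<^sub>Q c x) = 0" "x \<in> F"
  shows "c x = 0"
  using assms unfolding qindependent_def by blast

lemma qindependent_real: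
  assumes B: "qindependent B" "finite B"
  shows "inj_on (\<lambda>(b, u). b *\<^sub>Q u) (B \<times> quat_units)"
    "independent ((\<lambda>(b, u). b *\<^sub>Q u) ` (B \<times> quat_units))"
proof -
  let ?g = "\<lambda>(b, u). b *\<^sub>Q u"
  show inj: "inj_on ?g (B \<times> quat_units)"
  proof (rule inj_onI)
    fix s t assume "s \<in> B \<times> quat_units" "t \<in> B \<times> quat_units" "?g s = ?g t"
    then obtain b u b' u' where st: "s = (b, u)" "t = (b', u')" "b \<in> B" "b' \<in> B"
      "u \<in> quat_units" "u' \<in> quat_units" "b *\<^sub>Q u = b' *\<^sub>Q u'" by auto
    show "s = t"
    proof (cases "b = b'")
      case True
      have "u - u' = 0"
        using qindependentD[OF B(1), of "{b}" "\<lambda>_. u - u'" b] st True by (simp add: rscaleQ.diff_right)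
      then show ?thesis using st True by simp
    next
      case False
      have "u = 0"
        using qindependentD[OF B(1), of "{b, b'}" "\<lambda>x. if x = b then u else - u'" b] st False
        by (simp add: rscaleQ.minus_right)
      then show ?thesis using st zero_notin_quat_units by simp
    qed
  qed
  show "independent (?g ` (B \<times> quat_units))"
  proof (rule real_vector.independent_if_scalars_zero)
    show "finite (?g ` (B \<times> quat_units))"
      using B(2) card_quat_units by simp
    fix f x assume sum0: "(\<Sum>x\<in>?g ` (B \<times> quat_units). f x *\<^sub>R x) = 0" and x: "x \<in> ?g ` (B \<times> quat_units)"
    \<comment> \<open>The four real coefficients belonging to \<open>b\<close> are collected into
      one quaternion, so quaternionic independence applies.\<close>
    define c where "c b = (\<Sum>u\<in>quat_units. f (b *\<^sub>Q u) *\<^sub>R u)" for b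
    have "0 = (\<Sum>s\<in>B \<times> quat_units. f (?g s) *\<^sub>R ?g s)"
      using sum0 unfolding sum.reindex[OF inj] o_def by simp
    also have "\<dots> = (\<Sum>(b, u)\<in>B \<times> quat_units. f (b *\<^sub>Q u) *\<^sub>R (b *\<^sub>Q u))"
      by (simp add: case_prod_unfold)
    also have "\<dots> = (\<Sum>b\<in>B. b *\<^sub>Q c b)"
      by (simp add: c_def rscaleQ.sum_right rscaleQ_scaleR sum.cartesian_product)
    finally have c0: "c b = 0" if "b \<in> B" for b
      using qindependentD[OF B(1) B(2) subset_refl _ that, of c] by simp
    obtain b u where bu: "b \<in> B" "u \<in> quat_units" "x = b *\<^sub>Q u" using x by auto
    then show "f x = 0"
      using quat_units_independent[of "\<lambda>u. f (b *\<^sub>Q u)", OF _ bu(2)] c0[OF bu(1)] unfolding c_def by simp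
  qed
qed

lemma qspan_real:
  assumes "x \<in> qspan F"
  shows "x *\<^sub>Q q \<in> span ((\<lambda>(b, u). b *\<^sub>Q u) ` (F \<times> quat_units))"
proof -
  let ?T = "(\<lambda>(b, u). b *\<^sub>Q u) ` (F \<times> quat_units)"
  obtain G c where G: "finite G" "G \<subseteq> F" "x = (\<Sum>b\<in>G. b *\<^sub>Q c b)"
    using assms by (auto simp: qspan_def)
  have "b *\<^sub>Q q' \<in> span ?T" if "b \<in> G" for b q'
  proof -
    obtain r where "q' = (\<Sum>u\<in>quat_units. r u *\<^sub>R u)" using quat_units_combination by blast
    then have "b *\<^sub>Q q' = (\<Sum>u\<in>quat_units. r u *\<^sub>R (b *\<^sub>Q u))"
      by (simp add: rscaleQ.sum_right rscaleQ_scaleR)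
    also have "\<dots> \<in> span ?T"
      using that G(2) by (intro span_sum span_scale span_base) auto
    finally show ?thesis .
  qed
  then show ?thesis
    by (simp add: G(3) rscaleQ.sum_left span_sum flip: rscaleQ_mult)
qed

text \<open>Both sides are multiplied by 4 and compared as real dimensions. Finite subsets of
  \<open>B\<close> come before \<open>B\<close> itself, because their uniform bound is what makes
  \<open>B\<close> finite.\<close>

lemma qindependent_card_le:
  assumes B: "qindependent B" "B \<subseteq> qspan F" and F: "finite F"
  shows "finite B \<and> card B \<le> card F"
proof -
  have le: "card C \<le> card F" if "finite C" "C \<subseteq> B" for C
  proof -
    let ?g = "\<lambda>(b, u). b *\<^sub>Q u"
    have C: "qindependent C" using B(1) that(2) unfolding qindependent_def by blast
    have fin: "finite (?g ` (F \<times> quat_units))" using F card_quat_units by simp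
    have "?g ` (C \<times> quat_units) \<subseteq> span (?g ` (F \<times> quat_units))"
      using qspan_real B(2) that(2) by fastforce
    then have "card (?g ` (C \<times> quat_units)) \<le> card (?g ` (F \<times> quat_units))"
      using real_vector.independent_span_bound[OF fin qindependent_real(2)[OF C that(1)]] by blast
    also have "\<dots> \<le> card (F \<times> quat_units)"
      using F card_quat_units by (intro card_image_le) simp
    finally show ?thesis
      by (simp add: card_image[OF qindependent_real(1)[OF C that(1)]] card_cartesian_product card_quat_units)
  qed
  have "finite B"
  proof (rule ccontr)
    assume "infinite B"
    then obtain C where "C \<subseteq> B" "finite C" "card C = Suc (card F)"
      using infinite_arbitrarily_large by blast
    with le show False by fastforce
  qed
  with le show ?thesis by simp
qed

lemma qorthonormal_coefficient:
  assumes "qorthonormal E" "finite F" "F \<subseteq> E" "e \<in> E"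
  shows "qinner e (\<Sum>x\<in>F. x *\<^sub>Q c x) = (if e \<in> F then c e else 0)"
proof -
  have "qinner e (\<Sum>x\<in>F. x *\<^sub>Q c x) = (\<Sum>x\<in>F. if x = e then c x else 0)"
    unfolding qinner.sum_right qinner_rscaleQ_right
    using assms by (intro sum.cong) (auto simp: qorthonormal_def subset_iff)
  then show ?thesis using assms(2) by simp
qed

lemma qorthonormal_qindependent: "qorthonormal F \<Longrightarrow> qindependent F"
  unfolding qindependent_def
  by (metis qinner.zero_right qorthonormal_coefficient subsetD)

lemma qspan_superset: "B \<subseteq> qspan B"
proof
  fix b assume "b \<in> B"
  then show "b \<in> qspan B"
    unfolding qspan_def
    by (intro CollectI exI[of _ "{b}"] exI[of _ "\<lambda>_. 1"]) (simp add: rscaleQ_one)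
qed

text \<open>The basis chosen by \<open>SOME\<close> is arbitrary; the cardinality bound, applied in
  both directions, compares it with \<open>F\<close>.\<close>

lemma qdim_qspan:
  assumes F: "finite F" "qorthonormal F"
  shows "qdim (qspan F) = card F"
proof -
  let ?B = "SOME B. qindependent B \<and> qspan B = qspan F"
  have "\<exists>B. qindependent B \<and> qspan B = qspan F"
    using qorthonormal_qindependent[OF F(2)] by blast
  then have B: "qindependent ?B \<and> qspan ?B = qspan F" by (rule someI_ex)
  then have 1: "finite ?B \<and> card ?B \<le> card F"
    using qindependent_card_le[of ?B F] F(1) qspan_superset by metis
  moreover have "card F \<le> card ?B"
    using qindependent_card_le[of F ?B] B 1 qorthonormal_qindependent[OF F(2)] qspan_superset by metis
  ultimately show ?thesis by (simp add: qdim_def)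
qed

text \<open>An eigenvector \<open>x\<close> for \<open>l\<close> satisfies
  \<open>|T e| \<langle>e, x\<rangle> = l \<langle>e, x\<rangle>\<close>, so its coefficients vanish
  where \<open>|T e|\<close> differs from \<open>l\<close>.\<close>

lemma eigenspace_abs_op:
  fixes T :: "'a::quat_hilbert \<Rightarrow> 'a"
  assumes T: "T \<in> bounded_ops" and E: "singular_basis T E"
    and fin: "finite {e \<in> E. norm (T e) = l}"
  shows "qdim (real_eigenspace (abs_op T) l) = card {e \<in> E. norm (T e) = l}"
proof -
  let ?F = "{e \<in> E. norm (T e) = l}"
  note P = abs_op_singular_basis[OF T E]
  interpret P: bounded_linear "abs_op T" using P(1) by (rule bounded_opsD)
  have on: "qorthonormal E" and tot: "total_set E" using E by (auto simp: singular_basis_def)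
  have "real_eigenspace (abs_op T) l = qspan ?F"
  proof (intro equalityI subsetI)
    fix x assume "x \<in> real_eigenspace (abs_op T) l"
    then have x: "abs_op T x = l *\<^sub>R x" by (simp add: real_eigenspace_def rscaleQ_of_real)
    have "x = (\<Sum>e\<in>?F. e *\<^sub>Q qinner e x)"
    proof (rule total_set_eqI[OF tot])
      fix e assume e: "e \<in> E"
      have "norm (T e) *\<^sub>R qinner e x = l *\<^sub>R qinner e x"
        using P(2)[of e x] by (simp add: P(3)[OF e] x qinner_scaleR_left qinner_scaleR_right)
      then show "qinner e x = qinner e (\<Sum>e\<in>?F. e *\<^sub>Q qinner e x)"
        by (subst qorthonormal_coefficient[OF on fin _ e]) (use e in auto)
    qed
    then show "x \<in> qspan ?F" using fin by (auto simp: qspan_def)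
  next
    fix x assume "x \<in> qspan ?F"
    then obtain G c where G: "G \<subseteq> ?F" "x = (\<Sum>e\<in>G. e *\<^sub>Q c e)" by (auto simp: qspan_def)
    have "abs_op T x = (\<Sum>e\<in>G. abs_op T (e *\<^sub>Q c e))"
      by (simp add: G(2) P.sum)
    also have "\<dots> = (\<Sum>e\<in>G. l *\<^sub>R (e *\<^sub>Q c e))"
    proof (rule sum.cong)
      fix e assume "e \<in> G"
      then show "abs_op T (e *\<^sub>Q c e) = l *\<^sub>R (e *\<^sub>Q c e)"
        using G(1) P(3)[of e] by (auto simp: bounded_opsD(2)[OF P(1)] rscaleQ_scaleR)
    qed simp
    also have "\<dots> = l *\<^sub>R x" by (simp add: G(2) scaleR_sum_right)
    finally show "x \<in> real_eigenspace (abs_op T) l"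
      by (simp add: real_eigenspace_def rscaleQ_of_real)
  qed
  moreover have "qorthonormal ?F" using on by (auto simp: qorthonormal_def)
  ultimately show ?thesis using qdim_qspan[OF fin] by simp
qed

section \<open>Singular values\<close>

text \<open>\<open>s\<close> is the generalized inverse of the counting function \<open>N\<close>.
  The equivalences \<open>l \<le> s n \<longleftrightarrow> n < M l\<close> and
  \<open>l < s n \<longleftrightarrow> n < N l\<close> make the level set of \<open>l\<close> the
  interval \<open>{N l..<M l}\<close>.\<close>

lemma decreasing_rearrangement:
  fixes \<mu> :: "'i \<Rightarrow> real"
  assumes fin: "\<And>\<epsilon>. 0 < \<epsilon> \<Longrightarrow> finite {e \<in> I. \<epsilon> \<le> \<mu> e}"
  shows "\<exists>s. decseq s \<and> (\<forall>n. 0 \<le> s n) \<and>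
    (\<forall>l>0. finite {n. s n = l} \<and> card {n. s n = l} = card {e \<in> I. \<mu> e = l})"
proof -
  define M where "M l = card {e \<in> I. l \<le> \<mu> e}" for l
  define N where "N l = card {e \<in> I. l < \<mu> e}" for l
  have finN: "finite {e \<in> I. l < \<mu> e}" if "0 < l" for l
    by (rule finite_subset[OF _ fin[OF that]]) auto
  define A where "A n = {t. 0 < t \<and> N t \<le> n}" for n
  define s where "s n = Inf (A n)" for n
  have ne: "A n \<noteq> {}" for n
  proof -
    define t where "t = Max (insert 1 (\<mu> ` {e \<in> I. 1 \<le> \<mu> e}))"
    have t1: "1 \<le> t" unfolding t_def using fin[of 1] by (intro Max_ge) auto
    have "\<mu> e \<le> t" if "e \<in> I" for e
    proof (cases "1 \<le> \<mu> e")
      case True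
      then show ?thesis unfolding t_def using fin[of 1] that by (intro Max_ge) auto
    qed (use t1 in simp)
    then have no: "{e \<in> I. t < \<mu> e} = {}" by force
    have "t \<in> A n" using t1 by (simp add: A_def N_def no)
    then show ?thesis by blast
  qed
  have bdd: "bdd_below (A n)" for n
    by (rule bdd_belowI[of _ 0]) (auto simp: A_def)
  have s0: "0 \<le> s n" for n
    unfolding s_def using ne by (intro cInf_greatest) (auto simp: A_def)
  have dec: "decseq s"
    unfolding s_def by (rule decseq_SucI, rule cInf_superset_mono[OF ne bdd]) (auto simp: A_def)
  have le_iff: "l \<le> s n \<longleftrightarrow> n < M l" if l: "0 < l" for l n
  proof
    assume "n < M l"
    have "l \<le> t" if "t \<in> A n" for t
    proof (rule ccontr)
      assume "\<not> l \<le> t"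
      then have "M l \<le> N t"
        unfolding M_def N_def using that finN[of t] by (intro card_mono) (auto simp: A_def)
      with that \<open>n < M l\<close> show False by (simp add: A_def)
    qed
    then show "l \<le> s n" unfolding s_def using ne by (intro cInf_greatest)
  next
    assume ls: "l \<le> s n"
    show "n < M l"
    proof (rule ccontr)
      assume "\<not> n < M l"
      define V where "V = {e \<in> I. l / 2 \<le> \<mu> e \<and> \<mu> e < l}"
      \<comment> \<open>No value of \<open>\<mu>\<close> lies strictly between \<open>t\<close> and
        \<open>l\<close>, so \<open>t\<close> belongs to \<open>A n\<close> and shows
        \<open>s n < l\<close>. The cut at \<open>l / 2\<close> keeps \<open>t\<close> positive and
        \<open>V\<close> finite.\<close>
      define t where "t = Max (insert (l / 2) (\<mu> ` V))"
      have "finite V"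
        by (rule finite_subset[OF _ fin[of "l / 2"]]) (use l in \<open>auto simp: V_def\<close>)
      then have fV: "finite (insert (l / 2) (\<mu> ` V))" by simp
      have t: "l / 2 \<le> t" "\<And>e. e \<in> V \<Longrightarrow> \<mu> e \<le> t"
        unfolding t_def by (rule Max_ge[OF fV], simp)+
      have "t \<in> insert (l / 2) (\<mu> ` V)"
        unfolding t_def by (rule Max_in[OF fV]) simp
      then have t_less: "t < l" using l by (auto simp: V_def)
      have "{e \<in> I. t < \<mu> e} \<subseteq> {e \<in> I. l \<le> \<mu> e}"
      proof
        fix e assume "e \<in> {e \<in> I. t < \<mu> e}"
        then show "e \<in> {e \<in> I. l \<le> \<mu> e}" using t(2)[of e] t(1) by (force simp: V_def)
      qed
      then have "N t \<le> M l"
        unfolding M_def N_def using fin[OF l] by (rule card_mono[rotated])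
      then have "t \<in> A n" using \<open>\<not> n < M l\<close> t(1) l by (simp add: A_def)
      then have "s n \<le> t" unfolding s_def using bdd by (rule cInf_lower)
      with t_less ls show False by simp
    qed
  qed
  have less_iff: "l < s n \<longleftrightarrow> n < N l" if l: "0 < l" for l n
  proof
    assume "l < s n"
    then have "n < M (s n)" using le_iff[of "s n" n] l by simp
    also have "\<dots> \<le> N l"
      unfolding M_def N_def using finN[OF l] \<open>l < s n\<close> by (intro card_mono) auto
    finally show "n < N l" .
  next
    assume n: "n < N l"
    let ?V = "{e \<in> I. l < \<mu> e}"
    \<comment> \<open>The least value above \<open>l\<close>; then \<open>N l \<le> M l'\<close>,
      and the first equivalence gives \<open>l' \<le> s n\<close>.\<close>
    define l' where "l' = Min (\<mu> ` ?V)"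
    have "?V \<noteq> {}"
    proof
      assume "?V = {}"
      then have "N l = 0" unfolding N_def by (simp only: card.empty)
      with n show False by simp
    qed
    then have l': "l < l'" "\<And>e. e \<in> ?V \<Longrightarrow> l' \<le> \<mu> e"
      using finN[OF l] by (auto simp: l'_def)
    have "N l \<le> M l'"
      unfolding M_def N_def using l' l by (intro card_mono fin) auto
    then have "l' \<le> s n" using le_iff[of l' n] l' l n by simp
    with l'(1) show "l < s n" by simp
  qed
  have "finite {n. s n = l} \<and> card {n. s n = l} = card {e \<in> I. \<mu> e = l}" if l: "0 < l" for l
  proof -
    have "s n = l \<longleftrightarrow> n \<in> {N l..<M l}" for n
    proof -
      have "s n = l \<longleftrightarrow> l \<le> s n \<and> \<not> l < s n" by auto
      then show ?thesis by (auto simp: le_iff[OF l] less_iff[OF l])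
    qed
    then have "{n. s n = l} = {N l..<M l}" by blast
    moreover have "{e \<in> I. l \<le> \<mu> e} = {e \<in> I. \<mu> e = l} \<union> {e \<in> I. l < \<mu> e}" by auto
    then have "M l = card {e \<in> I. \<mu> e = l} + N l"
      unfolding M_def N_def using fin[OF l] by (subst card_Un_disjoint[symmetric]) auto
    ultimately show ?thesis by simp
  qed
  with dec s0 show ?thesis by blast
qed

text \<open>At the first index \<open>n\<close> with \<open>v n < u n\<close>, every index where
  \<open>v\<close> equals \<open>u n\<close> comes before \<open>n\<close>, where \<open>u\<close>
  and \<open>v\<close> agree. So \<open>u\<close> takes the value \<open>u n\<close>, which is
  positive, once more than \<open>v\<close> does.\<close>

lemma decseq_multiplicities_unique:
  fixes s s' :: "nat \<Rightarrow> real"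
  assumes s: "decseq s" "\<And>n. 0 \<le> s n" and s': "decseq s'" "\<And>n. 0 \<le> s' n"
    and mult: "\<And>l. 0 < l \<Longrightarrow> finite {n. s n = l} \<and> finite {n. s' n = l} \<and> card {n. s n = l} = card {n. s' n = l}"
  shows "s = s'"
proof -
  have step: "\<not> v n < u n"
    if u: "decseq v" "\<And>n. 0 \<le> v n" "\<And>m. m < n \<Longrightarrow> u m = v m"
      and c: "\<And>l. 0 < l \<Longrightarrow> finite {n. u n = l} \<and> card {n. u n = l} = card {n. v n = l}"
    for u v :: "nat \<Rightarrow> real" and n
  proof
    assume lt: "v n < u n"
    then have pos: "0 < u n" using u(2)[of n] by simp
    have "{m. v m = u n} \<subset> {m. u m = u n}"
    proof (rule psubsetI)
      show "{m. v m = u n} \<subseteq> {m. u m = u n}"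
      proof
        fix m assume "m \<in> {m. v m = u n}"
        then have m: "v m = u n" by simp
        have "m < n"
          using decseqD[OF u(1), of n m] lt m by (cases "m < n") auto
        with u(3) m show "m \<in> {m. u m = u n}" by simp
      qed
      have "n \<in> {m. u m = u n} - {m. v m = u n}" using lt by simp
      then show "{m. v m = u n} \<noteq> {m. u m = u n}" by blast
    qed
    then have "card {m. v m = u n} < card {m. u m = u n}"
      using c[OF pos] by (intro psubset_card_mono) auto
    with c[OF pos] show False by simp
  qed
  have "s n = s' n" for n
  proof (induction n rule: less_induct)
    case (less n)
    have "\<not> s' n < s n" using s' less mult by (intro step) auto
    moreover have "\<not> s n < s' n" using s less mult by (intro step) auto
    ultimately show ?case by simp
  qed
  then show ?thesis by blast
qed

text \<open>Bijections between level sets of equal size are glued together. The value 0 is left out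
  on both sides, as zeros of the sequence and basis vectors in the kernel need not match in
  number.\<close>

lemma singular_value_bij:
  fixes T :: "'a::quat_hilbert \<Rightarrow> 'a"
  assumes T: "T \<in> bounded_ops" "seq_compact_op T" and E: "singular_basis T E"
  obtains h where "bij_betw h {n. 0 < singular_value T n} {e \<in> E. T e \<noteq> 0}"
    "\<And>n. 0 < singular_value T n \<Longrightarrow> norm (T (h n)) = singular_value T n"
    "\<And>n. 0 \<le> singular_value T n"
proof -
  have fin: "finite {e \<in> E. \<epsilon> \<le> norm (T e)}" if "0 < \<epsilon>" for \<epsilon>
    using E that by (intro finite_large_images[OF T(2)]) (auto simp: singular_basis_def)
  have fin_eq: "finite {e \<in> E. norm (T e) = l}" if "0 < l" for l
    by (rule finite_subset[OF _ fin[OF that]]) auto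
  define R where "R s \<longleftrightarrow> decseq s \<and> (\<forall>n. 0 \<le> s n) \<and>
    (\<forall>l>0. finite {n. s n = l} \<and> card {n. s n = l} = card {e \<in> E. norm (T e) = l})" for s :: "nat \<Rightarrow> real"
  have "singular_value T = (THE s. R s)"
    unfolding singular_value_def R_def
    by (simp add: eigenspace_abs_op[OF T(1) E fin_eq] cong: conj_cong imp_cong)
  moreover have "\<exists>!s. R s"
  proof (rule ex_ex1I)
    show "\<exists>s. R s" unfolding R_def by (rule decreasing_rearrangement[OF fin])
    show "s = s'" if "R s" "R s'" for s s'
      using that unfolding R_def by (intro decseq_multiplicities_unique) auto
  qed
  ultimately have R: "R (singular_value T)" using theI'[of R] by simp
  let ?s = "singular_value T"
  have "\<exists>g. bij_betw g {n. ?s n = l} {e \<in> E. norm (T e) = l}" if "0 < l" for l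
    using R that fin_eq by (intro finite_same_card_bij) (auto simp: R_def)
  then obtain g where g: "\<And>l. 0 < l \<Longrightarrow> bij_betw (g l) {n. ?s n = l} {e \<in> E. norm (T e) = l}"
    by metis
  define h where "h n = g (?s n) n" for n
  have h: "h n \<in> E" "norm (T (h n)) = ?s n" if "0 < ?s n" for n
    using bij_betwE[OF g[OF that]] by (auto simp: h_def)
  have "bij_betw h {n. 0 < ?s n} {e \<in> E. T e \<noteq> 0}"
  proof (rule bij_betw_imageI)
    show "inj_on h {n. 0 < ?s n}"
    proof (rule inj_onI)
      fix m n assume mn: "m \<in> {n. 0 < ?s n}" "n \<in> {n. 0 < ?s n}" "h m = h n"
      then have eq: "?s m = ?s n" using h(2)[of m] h(2)[of n] by simp
      then show "m = n"
        using mn bij_betw_imp_inj_on[OF g[of "?s n"]] by (auto simp: h_def inj_on_def)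
    qed
    show "h ` {n. 0 < ?s n} = {e \<in> E. T e \<noteq> 0}"
    proof (intro equalityI subsetI)
      fix e assume "e \<in> h ` {n. 0 < ?s n}"
      then show "e \<in> {e \<in> E. T e \<noteq> 0}" using h by fastforce
    next
      fix e assume e: "e \<in> {e \<in> E. T e \<noteq> 0}"
      then have "e \<in> g (norm (T e)) ` {n. ?s n = norm (T e)}"
        using bij_betw_imp_surj_on[OF g[of "norm (T e)"]] by simp
      then obtain n where "?s n = norm (T e)" "e = g (norm (T e)) n" by auto
      with e show "e \<in> h ` {n. 0 < ?s n}" by (intro image_eqI[of _ _ n]) (auto simp: h_def)
    qed
  qed
  with h(2) R show ?thesis by (intro that) (auto simp: R_def)
qed

text \<open>The form with \<open>has_sum\<close> transfers summability and value together. Terms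
  outside the bijection vanish because \<open>0 powr p = 0\<close>.\<close>

lemma singular_value_has_sum:
  fixes T :: "'a::quat_hilbert \<Rightarrow> 'a"
  assumes T: "T \<in> bounded_ops" "seq_compact_op T" and E: "singular_basis T E"
  shows "((\<lambda>n. norm (singular_value T n) powr p) has_sum x) UNIV \<longleftrightarrow>
    ((\<lambda>e. norm (T e) powr p) has_sum x) E"
proof -
  let ?s = "singular_value T"
  obtain h where h: "bij_betw h {n. 0 < ?s n} {e \<in> E. T e \<noteq> 0}"
    "\<And>n. 0 < ?s n \<Longrightarrow> norm (T (h n)) = ?s n" "\<And>n. 0 \<le> ?s n"
    using singular_value_bij[OF T E] by blast
  have "((\<lambda>n. norm (?s n) powr p) has_sum x) UNIV \<longleftrightarrow>
      ((\<lambda>n. norm (T (h n)) powr p) has_sum x) {n. 0 < ?s n}"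
    using h(2,3) by (intro has_sum_cong_neutral) (auto simp: order_less_le)
  also have "\<dots> \<longleftrightarrow> ((\<lambda>e. norm (T e) powr p) has_sum x) {e \<in> E. T e \<noteq> 0}"
    by (rule has_sum_reindex_bij_betw[OF h(1)])
  also have "\<dots> \<longleftrightarrow> ((\<lambda>e. norm (T e) powr p) has_sum x) E"
    by (intro has_sum_cong_neutral) auto
  finally show ?thesis .
qed

lemma schatten_norm_singular_basis:
  fixes T :: "'a::quat_hilbert \<Rightarrow> 'a"
  assumes "T \<in> bounded_ops" "seq_compact_op T" "singular_basis T E"
  shows "schatten_norm p T = lp_norm p T E"
proof -
  have "(\<Sum>\<^sub>\<infinity>n. norm (singular_value T n) powr p) = (\<Sum>\<^sub>\<infinity>e\<in>E. norm (T e) powr p)"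
    using singular_value_has_sum[OF assms, of p]
    by (metis (no_types, lifting) has_sum_infsum infsumI infsum_not_exists summable_on_def)
  then show ?thesis
    by (simp add: schatten_norm_def lp_norm_def summable_on_def singular_value_has_sum[OF assms]
        del: real_norm_def)
qed

lemma summable_singular_value_iff:
  fixes T :: "'a::quat_hilbert \<Rightarrow> 'a"
  assumes "T \<in> bounded_ops" "seq_compact_op T" "singular_basis T E"
  shows "summable (\<lambda>n. singular_value T n powr p) \<longleftrightarrow> (\<lambda>e. norm (T e) powr p) summable_on E"
proof -
  have nonneg: "norm (singular_value T n) = singular_value T n" for n
    using singular_value_bij[OF assms] by (metis abs_of_nonneg real_norm_def)
  have "summable (\<lambda>n. singular_value T n powr p) \<longleftrightarrow>
      (\<lambda>n. singular_value T n powr p) summable_on UNIV"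
    by (simp add: summable_on_UNIV_nonneg_real_iff)
  also have "\<dots> \<longleftrightarrow> (\<lambda>n. norm (singular_value T n) powr p) summable_on UNIV"
    by (simp only: nonneg)
  also have "\<dots> \<longleftrightarrow> (\<lambda>e. norm (T e) powr p) summable_on E"
    by (simp only: summable_on_def singular_value_has_sum[OF assms])
  finally show ?thesis .
qed

section \<open>Bounding diagonal sums\<close>

text \<open>Convexity on the open half-line; the boundary cases \<open>a = 0\<close> and
  \<open>b = 0\<close> are computed directly.\<close>

lemma powr_tangent:
  fixes a b p :: real
  assumes "0 \<le> a" "0 \<le> b" "1 \<le> p"
  shows "a powr p + p * a powr (p - 1) * (b - a) \<le> b powr p"
proof (cases "a = 0 \<or> b = 0")
  case True
  show ?thesis
  proof (cases "a = 0")
    case False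
    then have "a powr (p - 1) * a = a powr p"
      using assms by (simp add: powr_diff)
    moreover have "b = 0" using True False by simp
    ultimately have "p * a powr (p - 1) * (b - a) = - (p * a powr p)"
      by (simp add: mult.assoc)
    moreover have "1 * a powr p \<le> p * a powr p"
      using assms(3) by (rule mult_right_mono) simp
    moreover have "0 \<le> b powr p" by simp
    ultimately show ?thesis by linarith
  qed simp
next
  case False
  then have ab: "0 < a" "0 < b" using assms by auto
  have "p * a powr (p - 1) * (b - a) \<le> b powr p - a powr p"
  proof (rule convex_on_imp_above_tangent[OF powr_convex[OF assms(3)]])
    show "((\<lambda>x. x powr p) has_real_derivative p * a powr (p - 1)) (at a within {0<..})"
      using ab by (auto intro!: derivative_eq_intros simp: powr_diff)
  qed (use ab in \<open>auto simp: interior_open\<close>)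
  then show ?thesis by simp
qed

text \<open>Jensen's inequality for total weight \<open>W\<close> at most 1. The tangent is taken at
  \<open>S\<close>, without normalizing the weights; \<open>p \<ge> 1\<close> gives
  \<open>1 \<le> W + p (1 - W)\<close>, which absorbs the missing weight.\<close>

lemma powr_weighted_sum_le:
  fixes \<mu> w :: "'i \<Rightarrow> real"
  assumes F: "finite F" and \<mu>: "\<And>e. e \<in> F \<Longrightarrow> 0 \<le> \<mu> e" and w: "\<And>e. e \<in> F \<Longrightarrow> 0 \<le> w e"
    and w1: "(\<Sum>e\<in>F. w e) \<le> 1" and p: "1 \<le> p"
  shows "(\<Sum>e\<in>F. \<mu> e * w e) powr p \<le> (\<Sum>e\<in>F. \<mu> e powr p * w e)"
proof -
  define S W where "S = (\<Sum>e\<in>F. \<mu> e * w e)" and "W = (\<Sum>e\<in>F. w e)"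
  have affine: "(\<Sum>e\<in>F. (a + b * (\<mu> e - c)) * w e) = a * W + b * (S - c * W)" for a b c
  proof -
    have "(\<Sum>e\<in>F. (a + b * (\<mu> e - c)) * w e)
        = (\<Sum>e\<in>F. a * w e + b * (\<mu> e * w e) - (b * c) * w e)"
      by (simp add: algebra_simps)
    then show ?thesis
      by (simp add: S_def W_def sum.distrib sum_subtractf algebra_simps flip: sum_distrib_left)
  qed
  have S0: "0 \<le> S" unfolding S_def by (intro sum_nonneg mult_nonneg_nonneg \<mu> w)
  have SS: "S powr (p - 1) * S = S powr p"
    using S0 p by (cases "S = 0") (auto simp: powr_diff)
  have "S powr p \<le> S powr p * (W + p * (1 - W))"
  proof -
    have "0 \<le> (p - 1) * (1 - W)" using p w1 by (simp add: W_def)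
    then have "1 \<le> W + p * (1 - W)" by (simp add: algebra_simps)
    then show ?thesis by (simp add: mult_le_cancel_left1)
  qed
  also have "\<dots> = S powr p * W + p * S powr (p - 1) * (S - S * W)"
    by (simp add: SS[symmetric] algebra_simps)
  also have "\<dots> = (\<Sum>e\<in>F. (S powr p + p * S powr (p - 1) * (\<mu> e - S)) * w e)"
    unfolding affine by (simp add: S_def W_def algebra_simps)
  also have "\<dots> \<le> (\<Sum>e\<in>F. \<mu> e powr p * w e)"
    by (intro sum_mono mult_right_mono powr_tangent S0 \<mu> w p)
  finally show ?thesis by (simp add: S_def)
qed

section \<open>Families satisfying Bessel's inequality\<close>

lemma norm_qinner_commute: "norm (qinner x y) = norm (qinner y x)"
  by (metis qinner_commute norm_qcnj)

definition suborthonormal :: "('i \<Rightarrow> 'a::quat_inner) \<Rightarrow> 'i set \<Rightarrow> bool"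
  where "suborthonormal x A \<longleftrightarrow> (\<forall>k\<in>A. norm (x k) \<le> 1) \<and>
    (\<forall>k\<in>A. \<forall>l\<in>A. k \<noteq> l \<longrightarrow> qinner (x k) (x l) = 0)"

lemma suborthonormal_subset: "suborthonormal x A \<Longrightarrow> B \<subseteq> A \<Longrightarrow> suborthonormal x B"
  by (simp add: suborthonormal_def subset_iff)

lemma qorthonormal_suborthonormal: "qorthonormal E \<Longrightarrow> suborthonormal (\<lambda>e. e) E"
  by (simp add: suborthonormal_def qorthonormal_norm) (simp add: qorthonormal_def)

text \<open>The inequality of the means splits each product into squares, to which Bessel's
  inequality applies separately.\<close>

lemma suborthonormal_products:
  fixes x y :: "'i \<Rightarrow> 'a::quat_inner"
  assumes "finite A" "suborthonormal x A" "suborthonormal y A" "norm u \<le> 1" "norm v \<le> 1"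
  shows "(\<Sum>k\<in>A. norm (qinner (x k) u) * norm (qinner (y k) v)) \<le> 1"
proof -
  have b: "(\<Sum>k\<in>A. (norm (qinner (z k) t))\<^sup>2) \<le> 1" if "suborthonormal z A" "norm t \<le> 1"
    for z :: "'i \<Rightarrow> 'a" and t
  proof -
    have "(\<Sum>k\<in>A. (norm (qinner (z k) t))\<^sup>2) \<le> (norm t)\<^sup>2"
      using that(1) assms(1) by (intro bessel) (auto simp: suborthonormal_def)
    also have "\<dots> \<le> 1" using that(2) by (simp add: power_le_one)
    finally show ?thesis .
  qed
  have "(\<Sum>k\<in>A. norm (qinner (x k) u) * norm (qinner (y k) v))
      \<le> (\<Sum>k\<in>A. ((norm (qinner (x k) u))\<^sup>2 + (norm (qinner (y k) v))\<^sup>2) / 2)"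
  proof (rule sum_mono)
    fix k
    show "norm (qinner (x k) u) * norm (qinner (y k) v)
        \<le> ((norm (qinner (x k) u))\<^sup>2 + (norm (qinner (y k) v))\<^sup>2) / 2"
      using sum_squares_bound[of "norm (qinner (x k) u)" "norm (qinner (y k) v)"] by simp
  qed
  also have "\<dots> = ((\<Sum>k\<in>A. (norm (qinner (x k) u))\<^sup>2) + (\<Sum>k\<in>A. (norm (qinner (y k) v))\<^sup>2)) / 2"
    by (simp add: sum.distrib flip: sum_divide_distrib)
  also have "\<dots> \<le> 1" using b[OF assms(2) assms(4)] b[OF assms(3) assms(5)] by simp
  finally show ?thesis .
qed

text \<open>On a singular basis this is the partial isometry of the polar decomposition. As
  \<open>inverse 0 = 0\<close>, it takes the value 0 on the kernel.\<close>

definition singular_image :: "('a::quat_inner \<Rightarrow> 'a) \<Rightarrow> 'a \<Rightarrow> 'a"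
  where "singular_image T e = inverse (norm (T e)) *\<^sub>R T e"

lemma singular_image: "T e = norm (T e) *\<^sub>R singular_image T e"
  by (cases "T e = 0") (simp_all add: singular_image_def)

lemma suborthonormal_singular_image:
  assumes "singular_basis T E" shows "suborthonormal (singular_image T) E"
proof -
  have "norm (singular_image T e) \<le> 1" for e
    by (cases "T e = 0") (simp_all add: singular_image_def)
  then show ?thesis
    using assms unfolding suborthonormal_def singular_basis_def
    by (simp add: singular_image_def qinner_scaleR_left qinner_scaleR_right)
qed

text \<open>The weights \<open>w k e = |\<langle>x\<^sub>k, f\<^sub>e\<rangle>| |\<langle>e, y\<^sub>k\<rangle>|\<close> with \<open>f\<^sub>e = T e / \<parallel>T e\<parallel>\<close> have row and column sums
  at most 1 by Bessel's inequality, so that Jensen's inequality applies row by row.\<close>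

lemma diagonal_sum_le_finite:
  fixes T :: "'a::quat_inner \<Rightarrow> 'a"
  assumes E: "singular_basis T E" and F: "finite F" "F \<subseteq> E" and A: "finite A"
    and x: "suborthonormal x A" and y: "suborthonormal y A" and p: "1 \<le> p"
  shows "(\<Sum>k\<in>A. norm (\<Sum>e\<in>F. qinner (x k) (T e) * qinner e (y k)) powr p) \<le> (\<Sum>e\<in>F. norm (T e) powr p)"
proof -
  let ?f = "singular_image T"
  define w where "w k e = norm (qinner (x k) (?f e)) * norm (qinner e (y k))" for k e
  have f: "suborthonormal ?f F" and eF: "suborthonormal (\<lambda>e. e) F"
    using suborthonormal_singular_image[OF E] qorthonormal_suborthonormal[of E] E
    by (simp_all add: suborthonormal_subset[OF _ F(2)] singular_basis_def)
  have rows: "(\<Sum>e\<in>F. w k e) \<le> 1" if "k \<in> A" for k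
    using suborthonormal_products[OF F(1) f eF, of "x k" "y k"] x y that
    by (simp add: w_def norm_qinner_commute[of "x k"] suborthonormal_def)
  have columns: "(\<Sum>k\<in>A. w k e) \<le> 1" if "e \<in> F" for e
    using suborthonormal_products[OF A x y, of "?f e" e] f eF that
    by (simp add: w_def norm_qinner_commute[of e] suborthonormal_def)
  have "norm (\<Sum>e\<in>F. qinner (x k) (T e) * qinner e (y k)) \<le> (\<Sum>e\<in>F. norm (T e) * w k e)" for k
  proof (rule sum_norm_le)
    fix e
    have "qinner (x k) (T e) = norm (T e) *\<^sub>R qinner (x k) (?f e)"
      by (subst singular_image) (rule qinner_scaleR_right)
    then show "norm (qinner (x k) (T e) * qinner e (y k)) \<le> norm (T e) * w k e"
      by (simp add: w_def norm_mult)
  qed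
  then have "(\<Sum>k\<in>A. norm (\<Sum>e\<in>F. qinner (x k) (T e) * qinner e (y k)) powr p)
      \<le> (\<Sum>k\<in>A. (\<Sum>e\<in>F. norm (T e) * w k e) powr p)"
    using p by (intro sum_mono powr_mono2) auto
  also have "\<dots> \<le> (\<Sum>k\<in>A. \<Sum>e\<in>F. norm (T e) powr p * w k e)"
    using F(1) rows p by (intro sum_mono powr_weighted_sum_le) (auto simp: w_def)
  also have "\<dots> = (\<Sum>e\<in>F. norm (T e) powr p * (\<Sum>k\<in>A. w k e))"
    by (subst sum.swap) (simp add: sum_distrib_left)
  also have "\<dots> \<le> (\<Sum>e\<in>F. norm (T e) powr p)"
    using columns by (intro sum_mono) (simp add: mult_left_le)
  finally show ?thesis .
qed

text \<open>The entries are limits of partial sums of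
  \<open>\<langle>x k, T e\<rangle> \<langle>e, y k\<rangle>\<close> over finite
  \<open>F \<subseteq> E\<close>, and the bound for finite \<open>F\<close> does not depend on
  \<open>F\<close>.\<close>

lemma diagonal_sum_le:
  fixes T :: "'a::quat_hilbert \<Rightarrow> 'a"
  assumes T: "T \<in> bounded_ops" and E: "singular_basis T E"
    and sm: "(\<lambda>e. norm (T e) powr p) summable_on E" and A: "finite A"
    and x: "suborthonormal x A" and y: "suborthonormal y A" and p: "1 \<le> p"
  shows "(\<Sum>k\<in>A. norm (qinner (x k) (T (y k))) powr p) \<le> (\<Sum>\<^sub>\<infinity>e\<in>E. norm (T e) powr p)"
proof -
  have on: "qorthonormal E" "total_set E" using E by (auto simp: singular_basis_def)
  have lim: "((\<lambda>F. \<Sum>e\<in>F. qinner (x k) (T e) * qinner e (y k)) \<longlongrightarrow> qinner (x k) (T (y k)))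
      (finite_subsets_at_top E)" for k
  proof -
    have "bounded_linear (\<lambda>v. qinner (x k) (T v))"
      by (rule bounded_linear_compose[OF qinner.bounded_linear_right bounded_opsD(1)[OF T]])
    from has_sum_bounded_linear[OF this onb_expansion[OF on, of "y k"]]
    show ?thesis by (simp add: has_sum_def bounded_opsD(2)[OF T] qinner_rscaleQ_right)
  qed
  have "((\<lambda>F. \<Sum>k\<in>A. norm (\<Sum>e\<in>F. qinner (x k) (T e) * qinner e (y k)) powr p) \<longlongrightarrow>
      (\<Sum>k\<in>A. norm (qinner (x k) (T (y k))) powr p)) (finite_subsets_at_top E)"
    using p by (intro tendsto_sum tendsto_powr' tendsto_norm lim tendsto_const) auto
  then show ?thesis
  proof (rule tendsto_upperbound)
    show "\<forall>\<^sub>F F in finite_subsets_at_top E.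
        (\<Sum>k\<in>A. norm (\<Sum>e\<in>F. qinner (x k) (T e) * qinner e (y k)) powr p)
        \<le> (\<Sum>\<^sub>\<infinity>e\<in>E. norm (T e) powr p)"
    proof (rule eventually_finite_subsets_at_top_weakI)
      fix F assume F: "finite F" "F \<subseteq> E"
      show "(\<Sum>k\<in>A. norm (\<Sum>e\<in>F. qinner (x k) (T e) * qinner e (y k)) powr p)
          \<le> (\<Sum>\<^sub>\<infinity>e\<in>E. norm (T e) powr p)"
        using diagonal_sum_le_finite[OF E F A x y p] finite_sum_le_infsum[OF sm F] by force
    qed
  qed simp
qed

lemma diagonal_infsum_le:
  fixes T :: "'a::quat_hilbert \<Rightarrow> 'a"
  assumes T: "T \<in> bounded_ops" and E: "singular_basis T E"
    and sm: "(\<lambda>e. norm (T e) powr p) summable_on E" and G: "qorthonormal G" and p: "1 \<le> p"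
  shows "(\<lambda>g. norm (qinner g (T g)) powr p) summable_on G"
    and "(\<Sum>\<^sub>\<infinity>g\<in>G. norm (qinner g (T g)) powr p) \<le> (\<Sum>\<^sub>\<infinity>e\<in>E. norm (T e) powr p)"
proof -
  have le: "(\<Sum>g\<in>F. norm (qinner g (T g)) powr p) \<le> (\<Sum>\<^sub>\<infinity>e\<in>E. norm (T e) powr p)"
    if F: "finite F" "F \<subseteq> G" for F
  proof -
    have "suborthonormal (\<lambda>g. g) F"
      by (rule suborthonormal_subset[OF qorthonormal_suborthonormal[OF G] F(2)])
    from diagonal_sum_le[OF T E sm F(1) this this p] show ?thesis .
  qed
  show sm': "(\<lambda>g. norm (qinner g (T g)) powr p) summable_on G"
    by (rule nonneg_bdd_above_summable_on) (auto intro!: bdd_aboveI2 le)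
  show "(\<Sum>\<^sub>\<infinity>g\<in>G. norm (qinner g (T g)) powr p) \<le> (\<Sum>\<^sub>\<infinity>e\<in>E. norm (T e) powr p)"
    using sm' le by (rule infsum_le_finite_sums)
qed

lemma lp_norm_diagonal_le:
  fixes T :: "'a::quat_hilbert \<Rightarrow> 'a"
  assumes "T \<in> bounded_ops" "singular_basis T E" "qorthonormal G" "1 \<le> p"
  shows "lp_norm p (\<lambda>g. qinner g (T g)) G \<le> lp_norm p T E"
proof (cases "(\<lambda>e. norm (T e) powr p) summable_on E")
  case True
  note le = diagonal_infsum_le[OF assms(1,2) True assms(3,4)]
  have "(\<Sum>\<^sub>\<infinity>g\<in>G. norm (qinner g (T g)) powr p) powr (1 / p)
      \<le> (\<Sum>\<^sub>\<infinity>e\<in>E. norm (T e) powr p) powr (1 / p)"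
    using le(2) assms(4) by (intro powr_mono2) (auto intro: infsum_nonneg)
  then show ?thesis
    using True le(1) by (simp add: lp_norm_def ennreal_leI)
qed (simp add: lp_norm_def)

text \<open>The constant comes from \<open>a + b \<le> 2 * max a b\<close>; its size is irrelevant
  where only boundedness is at stake.\<close>

lemma powr_add_le:
  fixes a b p :: real
  assumes "0 \<le> a" "0 \<le> b" "0 \<le> p"
  shows "(a + b) powr p \<le> 2 powr p * (a powr p + b powr p)"
proof -
  have "(a + b) powr p \<le> (2 * max a b) powr p"
    using assms by (intro powr_mono2) auto
  also have "\<dots> = 2 powr p * max a b powr p"
    using assms by (simp add: powr_mult)
  also have "\<dots> \<le> 2 powr p * (a powr p + b powr p)"
    by (intro mult_left_mono) (auto simp: max_def)
  finally show ?thesis .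
qed

section \<open>From summable diagonals to summable singular values\<close>

context complex_structure
begin

lemma norm_imag_unit: "norm i = 1"
  using i by (simp add: imag_units_def)

lemma selfadjoint_singular_basis:
  fixes A :: "'h \<Rightarrow> 'h"
  assumes A: "A \<in> bounded_ops" "seq_compact_op A" and sym: "\<And>x y. qinner (A x) y = qinner x (A y)"
    and AJ: "\<And>x. A (J x) = J (A x)"
  obtains E where "singular_basis A E" "qorthonormal E" "E \<subseteq> plus_space J i"
    "\<And>e. e \<in> E \<Longrightarrow> norm (qinner e (A e)) = norm (A e)"
proof -
  obtain E where E: "qorthonormal E" "E \<subseteq> plus_space J i" "total_set E"
    "\<And>e. e \<in> E \<Longrightarrow> \<exists>l::real. A e = l *\<^sub>R e"
    using spectral_theorem[OF A sym AJ] by blast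
  have "norm (qinner e (A e)) = norm (A e)" if e: "e \<in> E" for e
  proof -
    obtain l :: real where "A e = l *\<^sub>R e" using E(4)[OF e] by blast
    then show ?thesis
      using e E(1) by (simp add: qinner_scaleR_right qinner_self qorthonormal_norm[OF E(1) e])
  qed
  with E singular_basis_selfadjoint[OF E(1,3,4)] show ?thesis by (intro that)
qed

text \<open>On an eigenbasis of \<open>A\<close> the diagonal is \<open>|A e|\<close> in modulus, so
  domination by \<open>T\<close> makes \<open>|A e| powr p\<close> summable. Its sum serves as
  \<open>S\<close>, uniformly in the finite set and both families.\<close>

lemma dominated_selfadjoint_bound:
  fixes A T :: "'h \<Rightarrow> 'h"
  assumes A: "A \<in> bounded_ops" "seq_compact_op A" "\<And>x y. qinner (A x) y = qinner x (A y)"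
    "\<And>x. A (J x) = J (A x)"
    and sm: "\<And>E. qorthonormal E \<Longrightarrow> E \<subseteq> plus_space J i \<Longrightarrow>
        (\<lambda>e. norm (qinner e (T e)) powr p) summable_on E"
    and dom: "\<And>e. e \<in> plus_space J i \<Longrightarrow> norm (qinner e (A e)) \<le> norm (qinner e (T e))"
    and p: "1 \<le> p"
  shows "\<exists>S. \<forall>F x y. finite F \<longrightarrow> suborthonormal x F \<longrightarrow> suborthonormal y F \<longrightarrow>
    (\<Sum>k\<in>F. norm (qinner (x (k :: 'h)) (A (y k))) powr p) \<le> S"
proof -
  obtain E where E: "singular_basis A E" "qorthonormal E" "E \<subseteq> plus_space J i"
    "\<And>e. e \<in> E \<Longrightarrow> norm (qinner e (A e)) = norm (A e)"
    using selfadjoint_singular_basis[OF A] by blast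
  have "(\<lambda>e. norm (A e) powr p) summable_on E"
  proof (rule summable_on_comparison_test[OF sm[OF E(2,3)]])
    fix e assume e: "e \<in> E"
    then have "norm (A e) \<le> norm (qinner e (T e))"
      using dom[of e] E(3,4) by auto
    then show "norm (A e) powr p \<le> norm (qinner e (T e)) powr p"
      using p by (intro powr_mono2) auto
  qed simp
  from diagonal_sum_le[OF A(1) E(1) this _ _ _ p] show ?thesis by blast
qed

text \<open>Write \<open>T = A + C\<close> with \<open>A\<close> selfadjoint and \<open>C\<close> anti-selfadjoint; then \<open>J C\<close> is selfadjoint, and
  \<open>\<langle>e, J C e\<rangle> = \<langle>e, C e\<rangle> i\<close> on the plus space. The diagonals of both parts are dominated by that of
  \<open>T\<close>, and the singular values are off-diagonal coefficients \<open>\<langle>f\<^sub>e, A e\<rangle> + \<langle>f\<^sub>e, C e\<rangle>\<close>.\<close>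

lemma summable_diagonals_imp_summable:
  fixes T :: "'h \<Rightarrow> 'h"
  assumes T: "T \<in> bounded_ops" "seq_compact_op T" and TJ: "\<And>x. T (J x) = J (T x)"
    and E: "singular_basis T E" "E \<subseteq> plus_space J i" and p: "1 \<le> p"
    and sm: "\<And>E. qorthonormal E \<Longrightarrow> E \<subseteq> plus_space J i \<Longrightarrow>
        (\<lambda>e. norm (qinner e (T e)) powr p) summable_on E"
  shows "(\<lambda>e. norm (T e) powr p) summable_on E"
proof -
  let ?S = "qadjoint T"
  have S: "?S \<in> bounded_ops" "seq_compact_op ?S"
    using qadjoint_bounded_ops seq_compact_qadjoint T by blast+
  define A C where "A x = (1/2) *\<^sub>R (T x + ?S x)" and "C x = (1/2) *\<^sub>R (T x - ?S x)" for x
  have A: "A \<in> bounded_ops" and C: "C \<in> bounded_ops"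
    unfolding A_def[abs_def] C_def[abs_def]
    using T(1) S(1) by (auto intro: bounded_ops_half_add bounded_ops_half_diff)
  have cA: "seq_compact_op A" and cC: "seq_compact_op C"
    unfolding A_def[abs_def] C_def[abs_def] case_prod_unfold
    by (rule seq_compact_op_pair[OF T(2) S(2)], unfold case_prod_unfold, intro continuous_intros)+
  have AJ: "A (J x) = J (A x)" and CJ: "C (J x) = J (C x)" for x
    by (simp_all add: A_def C_def TJ qadjoint_J_commute[OF T(1) TJ] J.scaleR J.add J.diff)
  have symA: "qinner (A x) y = qinner x (A y)" for x y
    by (simp add: A_def qinner_scaleR_left qinner_scaleR_right qinner_add_left qinner_add_right
        qinner_qadjoint_left[OF T(1)] qinner_qadjoint_right[OF T(1)] add.commute)
  have skewC: "qinner (C x) y = - qinner x (C y)" for x y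
    by (simp add: C_def qinner_scaleR_left qinner_scaleR_right qinner.diff_left qinner.diff_right
        qinner_qadjoint_left[OF T(1)] qinner_qadjoint_right[OF T(1)] flip: scaleR_minus_right)
  \<comment> \<open>The two sign changes, from \<open>J\<close> and from \<open>C\<close>, cancel,
    and the factors commute.\<close>
  have symB: "qinner (J (C x)) y = qinner x (J (C y))" for x y
    by (simp add: J_skew skewC CJ)
  \<comment> \<open>The entries of \<open>qadjoint T\<close> on the diagonal are conjugates of those
    of \<open>T\<close>; the triangle inequality for the halves then gives domination for both
    parts.\<close>
  have adj_diag: "norm (qinner e (?S e)) = norm (qinner e (T e))" for e
    by (simp add: qinner_qadjoint_right[OF T(1)] norm_qinner_commute[of "T e"])
  have JC: "norm (qinner x (J (C e))) = norm (qinner x (C e))" if "e \<in> plus_space J i" for x e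
    using commute_plus_space[OF C CJ that]
    by (simp add: plus_space_def qinner_rscaleQ_right norm_mult norm_imag_unit)
  have "\<exists>S. \<forall>F x y. finite F \<longrightarrow> suborthonormal x F \<longrightarrow> suborthonormal y F \<longrightarrow>
      (\<Sum>k\<in>F. norm (qinner (x (k :: 'h)) (A (y k))) powr p) \<le> S"
  proof (rule dominated_selfadjoint_bound[OF A cA symA AJ sm _ p])
    fix e
    show "norm (qinner e (A e)) \<le> norm (qinner e (T e))"
      using norm_triangle_ineq[of "qinner e (T e)" "qinner e (?S e)"] adj_diag[of e]
      by (simp add: A_def qinner_scaleR_right qinner_add_right)
  qed
  then obtain SA where SA: "\<And>F x y. finite F \<Longrightarrow> suborthonormal x F \<Longrightarrow> suborthonormal y F \<Longrightarrow>
      (\<Sum>k\<in>F. norm (qinner (x (k :: 'h)) (A (y k))) powr p) \<le> SA" by blast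
  have "\<exists>S. \<forall>F x y. finite F \<longrightarrow> suborthonormal x F \<longrightarrow> suborthonormal y F \<longrightarrow>
      (\<Sum>k\<in>F. norm (qinner (x (k :: 'h)) (J (C (y k)))) powr p) \<le> S"
  proof (rule dominated_selfadjoint_bound[OF _ _ symB _ sm _ p])
    show "(\<lambda>x. J (C x)) \<in> bounded_ops" by (rule bounded_ops_comp[OF J(1) C])
    show "seq_compact_op (\<lambda>x. J (C x))"
      by (rule seq_compact_op_comp_left[OF J.bounded_linear_axioms cC])
    show "J (C (J x)) = J (J (C x))" for x by (simp add: CJ)
    fix e assume "e \<in> plus_space J i"
    then show "norm (qinner e (J (C e))) \<le> norm (qinner e (T e))"
      using norm_triangle_ineq4[of "qinner e (T e)" "qinner e (?S e)"] adj_diag[of e]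
      by (simp add: JC) (simp add: C_def qinner_scaleR_right qinner.diff_right)
  qed
  then obtain SC where SC: "\<And>F x y. finite F \<Longrightarrow> suborthonormal x F \<Longrightarrow> suborthonormal y F \<Longrightarrow>
      (\<Sum>k\<in>F. norm (qinner (x (k :: 'h)) (J (C (y k)))) powr p) \<le> SC" by blast
  let ?f = "singular_image T"
  show ?thesis
  proof (rule nonneg_bdd_above_summable_on)
    show "bdd_above (sum (\<lambda>e. norm (T e) powr p) ` {F. F \<subseteq> E \<and> finite F})"
    proof (rule bdd_aboveI2)
      fix F assume "F \<in> {F. F \<subseteq> E \<and> finite F}"
      then have F: "F \<subseteq> E" "finite F" by auto
      have so: "suborthonormal ?f F" "suborthonormal (\<lambda>e. e) F"
        using suborthonormal_singular_image[OF E(1)] qorthonormal_suborthonormal[of E] E(1)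
        by (simp_all add: suborthonormal_subset[OF _ F(1)] singular_basis_def)
      have "norm (T e) powr p \<le> 2 powr p *
          (norm (qinner (?f e) (A e)) powr p + norm (qinner (?f e) (J (C e))) powr p)" if "e \<in> F" for e
      proof -
        have split: "A e + C e = T e"
          by (simp add: A_def C_def algebra_simps flip: scaleR_add_left)
        \<comment> \<open>Pairing \<open>T e\<close> with its own direction recovers its norm; for
          \<open>T e = 0\<close> both sides are 0.\<close>
        have "norm (T e) = norm (qinner (?f e) (T e))"
          by (cases "T e = 0")
            (simp_all add: singular_image_def qinner_scaleR_left qinner_self power2_eq_square norm_mult)
        also have "\<dots> \<le> norm (qinner (?f e) (A e)) + norm (qinner (?f e) (C e))"
          unfolding split[symmetric] qinner_add_right by (rule norm_triangle_ineq)
        finally have "norm (T e) \<le> norm (qinner (?f e) (A e)) + norm (qinner (?f e) (J (C e)))"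
          using JC[of e] that F(1) E(2) by auto
        then have "norm (T e) powr p
            \<le> (norm (qinner (?f e) (A e)) + norm (qinner (?f e) (J (C e)))) powr p"
          using p by (intro powr_mono2) auto
        also have "\<dots> \<le> 2 powr p *
            (norm (qinner (?f e) (A e)) powr p + norm (qinner (?f e) (J (C e))) powr p)"
          using p by (intro powr_add_le) auto
        finally show ?thesis .
      qed
      then have "(\<Sum>e\<in>F. norm (T e) powr p) \<le> (\<Sum>e\<in>F. 2 powr p *
          (norm (qinner (?f e) (A e)) powr p + norm (qinner (?f e) (J (C e))) powr p))"
        by (rule sum_mono)
      also have "\<dots> = 2 powr p * ((\<Sum>e\<in>F. norm (qinner (?f e) (A e)) powr p)
          + (\<Sum>e\<in>F. norm (qinner (?f e) (J (C e))) powr p))"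
        by (simp add: sum.distrib flip: sum_distrib_left)
      also have "\<dots> \<le> 2 powr p * (SA + SC)"
        using SA[OF F(2) so] SC[OF F(2) so] by (intro mult_left_mono add_mono) auto
      finally show "(\<Sum>e\<in>F. norm (T e) powr p) \<le> 2 powr p * (SA + SC)" .
    qed
  qed simp
qed

end

theorem theorem3p24:
  fixes J T :: "'h::quat_hilbert \<Rightarrow> 'h" and i :: quat and p :: real
  assumes "separable_space (euclidean :: 'h topology)"
    and "J \<in> bounded_ops" and "anti_selfadjoint J" and "unitary J"
    and "i \<in> imag_units"
    and "T \<in> compact_ops" and "commutator T J = (\<lambda>x. 0)"
    and "1 \<le> p"
  shows "(T \<in> schatten_class p J \<longleftrightarrow>
      (\<forall>E. qorthonormal E \<and> E \<subseteq> plus_space J i \<longrightarrow>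
        (\<lambda>e. norm (qinner e (T e)) powr p) summable_on E))
    \<and> (selfadjoint T \<longrightarrow>
      schatten_norm p T =
        (SUP E \<in> {E. qorthonormal E \<and> E \<subseteq> plus_space J i}. lp_norm p (\<lambda>e. qinner e (T e)) E))"
proof -
  interpret complex_structure J i
    by standard fact+
  have T: "T \<in> bounded_ops" "seq_compact_op T"
    using assms(6) compact_ops_seq_compact by (auto simp: compact_ops_def)
  have TJ: "T (J x) = J (T x)" for x
    using fun_cong[OF assms(7), of x] by (simp add: commutator_def)
  obtain E where E: "singular_basis T E" "E \<subseteq> plus_space J i"
    using singular_basis_exists[OF T TJ] by blast
  have "T \<in> schatten_class p J \<longleftrightarrow> (\<lambda>e. norm (T e) powr p) summable_on E"
    using assms(6,7) by (simp add: schatten_class_def summable_singular_value_iff[OF T E(1)])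
  also have "\<dots> \<longleftrightarrow> (\<forall>E. qorthonormal E \<and> E \<subseteq> plus_space J i \<longrightarrow>
      (\<lambda>e. norm (qinner e (T e)) powr p) summable_on E)"
    using diagonal_infsum_le(1)[OF T(1) E(1) _ _ assms(8)]
      summable_diagonals_imp_summable[OF T TJ E assms(8)] by blast
  finally have 1: "T \<in> schatten_class p J \<longleftrightarrow> (\<forall>E. qorthonormal E \<and> E \<subseteq> plus_space J i \<longrightarrow>
      (\<lambda>e. norm (qinner e (T e)) powr p) summable_on E)" .
  have 2: "schatten_norm p T =
      (SUP E \<in> {E. qorthonormal E \<and> E \<subseteq> plus_space J i}. lp_norm p (\<lambda>e. qinner e (T e)) E)"
    if "selfadjoint T"
  proof -
    have "qinner (T x) y = qinner x (T y)" for x y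
      using qinner_qadjoint_left[OF T(1), of x y] that by (simp add: selfadjoint_def)
    \<comment> \<open>The Schatten norm may be computed in any singular basis. An eigenbasis of
      \<open>T\<close> in the plus space is chosen, so that the supremum is attained at
      \<open>B\<close>.\<close>
    then obtain B where B: "singular_basis T B" "qorthonormal B" "B \<subseteq> plus_space J i"
      "\<And>e. e \<in> B \<Longrightarrow> norm (qinner e (T e)) = norm (T e)"
      using selfadjoint_singular_basis[OF T _ TJ] by blast
    have "lp_norm p (\<lambda>e. qinner e (T e)) B = lp_norm p T B"
      by (simp add: lp_norm_def B(4) cong: summable_on_cong infsum_cong)
    moreover have "schatten_norm p T = lp_norm p T B"
      by (rule schatten_norm_singular_basis[OF T B(1)])
    ultimately show ?thesis
      using B(2,3) lp_norm_diagonal_le[OF T(1) B(1) _ assms(8)]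
      by (intro antisym SUP_least) (auto intro: SUP_upper2[of B])
  qed
  from 1 2 show ?thesis by blast
qed

end
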